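(* Chain field theories are invariant under thin $2$-morphisms: let $E:\mathtt{Chain}^{n+1}(X)\to\mathbb C\text{-}\mathtt{Lines}$ be a chain field theory, let $x,x'\in Z_n(X;\mathbb Z)$ be objects and $x\xrightarrow{a}x'$, $x\xrightarrow{a'}x'$ morphisms in $\mathtt{Chain}^{n+1}(X)$. Let $b\in S_{n+2}(X;\mathbb Z)$ be a thin chain with $\partial b=a'-a$, i.e. $a\overset{b}{\Rightarrow}a'$ is a thin $2$-morphism. Then $$E(x\xrightarrow{a}x')=E(x\xrightarrow{a'}x').$$
   Context: $X$ is a smooth space (e.g. a smooth manifold); $C_m(X;\mathbb Z)\supset Z_m(X;\mathbb Z)$ are the groups of smooth singular $m$-chains and $m$-cycles, $\Omega^m(X)$ the $m$-forms. $S_m(X;\mathbb Z)\subset C_m(X;\mathbb Z)$ is the subgroup of thin chains: chains $y$ with $\int_y\omega=0$ for all $\omega\in\Omega^m(X)$. The category $\mathtt{Chain}^{n+1}(X)$ has as objects the cycles $x\in Z_n(X;\mathbb Z)$; a morphism $x\xrightarrow{a}x'$ is a chain $a\in C_{n+1}(X;\mathbb Z)$ with $\partial a=x'-x$; composition is addition of chains; identities are the zero chains. Addition of cycles and chains as tensor product makes it a strict symmetric monoidal groupoid with unit object $0$. Every $z\in Z_{n+1}(X;\mathbb Z)$ is an automorphism of every object. A $2$-morphism $a\overset{b}{\Rightarrow}a'$ between morphisms $x\xrightarrow{a}x'$, $x\xrightarrow{a'}x'$ is a chain $b\in C_{n+2}(X;\mathbb Z)$ with $\partial b=a'-a$; it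 is thin if $b\in S_{n+2}(X;\mathbb Z)$. $\mathbb C\text{-}\mathtt{Lines}$ is the symmetric monoidal category of Hermitian lines and isometries (with unit $\mathbb C$, whose automorphism group is $\mathrm U(1)$). A chain field theory on $X$ is a symmetric monoidal functor $E:\mathtt{Chain}^{n+1}(X)\to\mathbb C\text{-}\mathtt{Lines}$ satisfying the smoothness condition: there is a closed form $\omega\in\Omega^{n+2}(X)$ such that for every $b\in C_{n+2}(X;\mathbb Z)$, $E(0\xrightarrow{\partial b}0)=\exp(2\pi i\int_b\omega)\in\mathrm U(1)$, where automorphisms of $E(0)\cong\mathbb C$ are identified with elements of $\mathrm U(1)$. *)

theory Defs
  imports "HOL-Analysis.Analysis" "HOL-Homology.Homology"
begin

section \<open>Smooth maps between open subsets of Euclidean spaces\<close>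

text \<open>
  The dimension varies inside the definitions below, so \<open>\<real>\<^sup>k\<close> is the library's
  \<^const>\<open>Euclidean_space\<close>, whose points are the functions \<^typ>\<open>nat \<Rightarrow> real\<close>
  vanishing at all indices \<open>\<ge> k\<close>.
\<close>

abbreviation Rn :: "nat \<Rightarrow> (nat \<Rightarrow> real) set" where
  "Rn k \<equiv> topspace (Euclidean_space k)"

definition partial_deriv :: "nat \<Rightarrow> ((nat \<Rightarrow> real) \<Rightarrow> real) \<Rightarrow> (nat \<Rightarrow> real) \<Rightarrow> real" where
  "partial_deriv i f x = deriv (\<lambda>t. f (x(i := t))) (x i)"

text \<open>\<open>Ck_on k r U f\<close>: \<open>f\<close> is of class \<open>C\<^sup>r\<close> on the open set \<open>U \<subseteq> \<real>\<^sup>k\<close>.\<close>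

primrec Ck_on :: "nat \<Rightarrow> nat \<Rightarrow> (nat \<Rightarrow> real) set \<Rightarrow> ((nat \<Rightarrow> real) \<Rightarrow> real) \<Rightarrow> bool" where
  "Ck_on k 0 U f \<longleftrightarrow> continuous_on U f"
| "Ck_on k (Suc r) U f \<longleftrightarrow> continuous_on U f \<and>
     (\<forall>i<k. (\<forall>x\<in>U. (\<lambda>t. f (x(i := t))) differentiable (at (x i))) \<and>
            Ck_on k r U (partial_deriv i f))"

definition smooth_fun_on :: "nat \<Rightarrow> (nat \<Rightarrow> real) set \<Rightarrow> ((nat \<Rightarrow> real) \<Rightarrow> real) \<Rightarrow> bool" where
  "smooth_fun_on k U f \<longleftrightarrow> (\<forall>r. Ck_on k r U f)"

text \<open>\<open>smooth_map k U l S \<phi>\<close>: \<open>\<phi>\<close> is smooth from the open set \<open>U \<subseteq> \<real>\<^sup>k\<close> to \<open>\<real>\<^sup>l\<close>, with values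
  in the (arbitrary) subset \<open>S \<subseteq> \<real>\<^sup>l\<close>.\<close>

definition smooth_map ::
  "nat \<Rightarrow> (nat \<Rightarrow> real) set \<Rightarrow> nat \<Rightarrow> (nat \<Rightarrow> real) set \<Rightarrow> ((nat \<Rightarrow> real) \<Rightarrow> nat \<Rightarrow> real) \<Rightarrow> bool" where
  "smooth_map k U l S \<phi> \<longleftrightarrow>
     \<phi> \<in> U \<rightarrow> S \<inter> Rn l \<and> (\<forall>j<l. smooth_fun_on k U (\<lambda>x. \<phi> x j))"


section \<open>Smooth spaces\<close>

text \<open>
  Smooth spaces are diffeological spaces: a set together with its smooth parametrizations
  (plots) by open subsets of all \<open>\<real>\<^sup>k\<close>.  A smooth manifold is a smooth space by taking as plots
  all smooth maps into it; smooth maps, differential forms and smooth singular simplices of a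
  manifold are the same in both senses.
\<close>

record 'a diffeology =
  points :: "'a set"
  plots :: "nat \<Rightarrow> (nat \<Rightarrow> real) set \<Rightarrow> ((nat \<Rightarrow> real) \<Rightarrow> 'a) set"

locale smooth_space =
  fixes X :: "'a diffeology"
  assumes plots_open: "P \<in> plots X k U \<Longrightarrow> openin (Euclidean_space k) U"
    and plots_funcset: "P \<in> plots X k U \<Longrightarrow> P \<in> U \<rightarrow>\<^sub>E points X"
    and plots_const: "\<lbrakk>openin (Euclidean_space k) U; x \<in> points X\<rbrakk> \<Longrightarrow> (\<lambda>u\<in>U. x) \<in> plots X k U"
    and plots_local: "\<lbrakk>openin (Euclidean_space k) U; P \<in> U \<rightarrow>\<^sub>E points X;
        \<And>u. u \<in> U \<Longrightarrow> \<exists>V. openin (Euclidean_space k) V \<and> u \<in> V \<and> V \<subseteq> U \<and> restrict P V \<in> plots X k V\<rbrakk>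
        \<Longrightarrow> P \<in> plots X k U"
    and plots_compose: "\<lbrakk>P \<in> plots X l V; openin (Euclidean_space k) U; smooth_map k U l V \<phi>\<rbrakk>
        \<Longrightarrow> compose U P \<phi> \<in> plots X k U"


section \<open>Differential forms\<close>

text \<open>An \<open>m\<close>-form on \<open>U \<subseteq> \<real>\<^sup>k\<close> takes a point and a list of \<open>m\<close> tangent vectors.\<close>

definition vec_lists :: "nat \<Rightarrow> nat \<Rightarrow> (nat \<Rightarrow> real) list set" where
  "vec_lists k m = {vs. length vs = m \<and> set vs \<subseteq> Rn k}"

definition alternating_form :: "nat \<Rightarrow> nat \<Rightarrow> ((nat \<Rightarrow> real) list \<Rightarrow> real) \<Rightarrow> bool" where
  "alternating_form k m \<alpha> \<longleftrightarrow>
     (\<forall>vs\<in>vec_lists k m. \<forall>i<m. \<forall>u\<in>Rn k. \<forall>w\<in>Rn k. \<forall>c.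
        \<alpha> (vs[i := (\<lambda>j. c * u j + w j)]) = c * \<alpha> (vs[i := u]) + \<alpha> (vs[i := w])) \<and>
     (\<forall>vs\<in>vec_lists k m. \<forall>i<m. \<forall>j<m. i \<noteq> j \<longrightarrow> vs ! i = vs ! j \<longrightarrow> \<alpha> vs = 0)"

definition form_on ::
  "nat \<Rightarrow> nat \<Rightarrow> (nat \<Rightarrow> real) set \<Rightarrow> ((nat \<Rightarrow> real) \<Rightarrow> (nat \<Rightarrow> real) list \<Rightarrow> real) \<Rightarrow> bool" where
  "form_on m k U \<eta> \<longleftrightarrow>
     (\<forall>x\<in>U. alternating_form k m (\<eta> x)) \<and>
     (\<forall>vs\<in>vec_lists k m. smooth_fun_on k U (\<lambda>x. \<eta> x vs))"

definition total_deriv ::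
  "nat \<Rightarrow> ((nat \<Rightarrow> real) \<Rightarrow> real) \<Rightarrow> (nat \<Rightarrow> real) \<Rightarrow> (nat \<Rightarrow> real) \<Rightarrow> real" where
  "total_deriv k f x v = (\<Sum>i<k. partial_deriv i f x * v i)"

definition pullback ::
  "nat \<Rightarrow> nat \<Rightarrow> ((nat \<Rightarrow> real) \<Rightarrow> nat \<Rightarrow> real)
    \<Rightarrow> ((nat \<Rightarrow> real) \<Rightarrow> (nat \<Rightarrow> real) list \<Rightarrow> real) \<Rightarrow> (nat \<Rightarrow> real) \<Rightarrow> (nat \<Rightarrow> real) list \<Rightarrow> real" where
  "pullback k l \<phi> \<eta> x vs =
     \<eta> (\<phi> x) (map (\<lambda>v j. if j < l then total_deriv k (\<lambda>y. \<phi> y j) x v else 0) vs)"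

text \<open>Cartan's formula on constant vector fields, whose brackets vanish:
  \<open>d\<eta>(v\<^sub>0,\<dots>,v\<^sub>m) = \<Sum>\<^sub>i (-1)\<^sup>i \<partial>\<^bsub>v\<^sub>i\<^esub> \<eta>(v\<^sub>0,\<dots>,v\<^sub>i omitted,\<dots>,v\<^sub>m)\<close>.\<close>

definition ext_deriv ::
  "nat \<Rightarrow> ((nat \<Rightarrow> real) \<Rightarrow> (nat \<Rightarrow> real) list \<Rightarrow> real) \<Rightarrow> (nat \<Rightarrow> real) \<Rightarrow> (nat \<Rightarrow> real) list \<Rightarrow> real" where
  "ext_deriv k \<eta> x vs =
     (\<Sum>i<length vs. (-1) ^ i * total_deriv k (\<lambda>y. \<eta> y (take i vs @ drop (Suc i) vs)) x (vs ! i))"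

text \<open>A form on a smooth space is a family of forms on the domains of its plots, compatible with
  reparametrization.\<close>

type_synonym 'a form_family =
  "nat \<Rightarrow> (nat \<Rightarrow> real) set \<Rightarrow> ((nat \<Rightarrow> real) \<Rightarrow> 'a) \<Rightarrow> (nat \<Rightarrow> real) \<Rightarrow> (nat \<Rightarrow> real) list \<Rightarrow> real"

definition forms :: "'a diffeology \<Rightarrow> nat \<Rightarrow> 'a form_family set" where
  "forms X m = {\<omega>.
     (\<forall>k U. \<forall>P\<in>plots X k U. form_on m k U (\<omega> k U P)) \<and>
     (\<forall>l V k U \<phi>. \<forall>P\<in>plots X l V. openin (Euclidean_space k) U \<longrightarrow> smooth_map k U l V \<phi> \<longrightarrow>
        (\<forall>x\<in>U. \<forall>vs\<in>vec_lists k m. \<omega> k U (compose U P \<phi>) x vs = pullback k l \<phi> (\<omega> l V P) x vs))}"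

definition closed_form :: "'a diffeology \<Rightarrow> nat \<Rightarrow> 'a form_family \<Rightarrow> bool" where
  "closed_form X m \<omega> \<longleftrightarrow> \<omega> \<in> forms X m \<and>
     (\<forall>k U. \<forall>P\<in>plots X k U. \<forall>x\<in>U. \<forall>vs\<in>vec_lists k (Suc m). ext_deriv k (\<omega> k U P) x vs = 0)"


section \<open>Smooth singular chains and integration\<close>

text \<open>A simplex is smooth if it is smooth for the subset diffeology of
  \<open>\<Delta>\<^sup>p \<subseteq> \<real>\<^sup>p\<^sup>+\<^sup>1\<close>.\<close>

definition smooth_simplex :: "'a diffeology \<Rightarrow> nat \<Rightarrow> ((nat \<Rightarrow> real) \<Rightarrow> 'a) \<Rightarrow> bool" where
  "smooth_simplex X p \<sigma> \<longleftrightarrow> \<sigma> \<in> standard_simplex p \<rightarrow>\<^sub>E points X \<and>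
     (\<forall>k U \<phi>. openin (Euclidean_space k) U \<longrightarrow> smooth_map k U (Suc p) (standard_simplex p) \<phi> \<longrightarrow>
        compose U \<sigma> \<phi> \<in> plots X k U)"

definition smooth_chains :: "'a diffeology \<Rightarrow> nat \<Rightarrow> 'a chain set" where
  "smooth_chains X p = {c. Poly_Mapping.keys c \<subseteq> Collect (smooth_simplex X p)}"

definition smooth_cycles :: "'a diffeology \<Rightarrow> nat \<Rightarrow> 'a chain set" where
  "smooth_cycles X p = {c \<in> smooth_chains X p. chain_boundary p c = 0}"

text \<open>The open \<open>m\<close>-simplex \<open>{t\<^sub>i > 0, \<Sum>t\<^sub>i < 1} \<subseteq> \<real>\<^sup>m\<close> parametrizes the interior of \<open>\<Delta>\<^sup>m\<close> by
  \<open>t \<mapsto> (1 - \<Sum>t\<^sub>i, t\<^sub>0, \<dots>, t\<^sub>m\<^sub>-\<^sub>1)\<close>, i.e.\ with the vertex order as orientation.  Since the boundary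
  of \<open>\<Delta>\<^sup>m\<close> is a null set, integrals over \<open>\<Delta>\<^sup>m\<close> can be taken over its interior.\<close>

definition open_simplex :: "nat \<Rightarrow> (nat \<Rightarrow> real) set" where
  "open_simplex m = {t \<in> Rn m. (\<forall>i<m. 0 < t i) \<and> (\<Sum>i<m. t i) < 1}"

definition barycentric :: "nat \<Rightarrow> (nat \<Rightarrow> real) \<Rightarrow> nat \<Rightarrow> real" where
  "barycentric m t i = (if i = 0 then 1 - (\<Sum>j<m. t j) else if i \<le> m then t (i - 1) else 0)"

text \<open>The points of the product measure space are \<^const>\<open>undefined\<close>, not \<open>0\<close>, beyond \<open>m\<close>.\<close>

definition integral_Rn :: "nat \<Rightarrow> (nat \<Rightarrow> real) set \<Rightarrow> ((nat \<Rightarrow> real) \<Rightarrow> real) \<Rightarrow> real" where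
  "integral_Rn m S f =
     (\<integral>t. (let u = (\<lambda>i. if i < m then t i else 0) in indicator S u * f u)
       \<partial>(\<Pi>\<^sub>M i\<in>{..<m}. lborel))"

definition simplex_integral :: "nat \<Rightarrow> 'a form_family \<Rightarrow> ((nat \<Rightarrow> real) \<Rightarrow> 'a) \<Rightarrow> real" where
  "simplex_integral m \<omega> \<sigma> =
     integral_Rn m (open_simplex m)
       (\<lambda>t. \<omega> m (open_simplex m) (compose (open_simplex m) \<sigma> (barycentric m)) t
              (map (\<lambda>i j. if j = i then 1 else 0) [0..<m]))"

definition chain_integral :: "nat \<Rightarrow> 'a form_family \<Rightarrow> 'a chain \<Rightarrow> real" where
  "chain_integral m \<omega> c =
     (\<Sum>\<sigma>\<in>Poly_Mapping.keys c. real_of_int (Poly_Mapping.lookup c \<sigma>) * simplex_integral m \<omega> \<sigma>)"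

definition thin_chains :: "'a diffeology \<Rightarrow> nat \<Rightarrow> 'a chain set" where
  "thin_chains X m = {y \<in> smooth_chains X m. \<forall>\<omega>\<in>forms X m. chain_integral m \<omega> y = 0}"


section \<open>Symmetric monoidal categories and functors\<close>

record ('o, 'm) moncat =
  Obj :: "'o set"
  Arr :: "'m set"
  Dom :: "'m \<Rightarrow> 'o"
  Cod :: "'m \<Rightarrow> 'o"
  Ident :: "'o \<Rightarrow> 'm"
  Comp :: "'m \<Rightarrow> 'm \<Rightarrow> 'm"  (infixr "\<odot>\<index>" 70)
  TensorO :: "'o \<Rightarrow> 'o \<Rightarrow> 'o"  (infixr "\<boxdot>\<index>" 75)
  TensorA :: "'m \<Rightarrow> 'm \<Rightarrow> 'm"  (infixr "\<boxtimes>\<index>" 75)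
  UnitO :: "'o"
  Assoc :: "'o \<Rightarrow> 'o \<Rightarrow> 'o \<Rightarrow> 'm"
  LUnit :: "'o \<Rightarrow> 'm"
  RUnit :: "'o \<Rightarrow> 'm"
  Braid :: "'o \<Rightarrow> 'o \<Rightarrow> 'm"

definition homset :: "('o, 'm) moncat \<Rightarrow> 'o \<Rightarrow> 'o \<Rightarrow> 'm set" where
  "homset C x y = {f \<in> Arr C. Dom C f = x \<and> Cod C f = y}"

definition isos :: "('o, 'm) moncat \<Rightarrow> 'o \<Rightarrow> 'o \<Rightarrow> 'm set" where
  "isos C x y = {f \<in> homset C x y. \<exists>g\<in>homset C y x. Comp C g f = Ident C x \<and> Comp C f g = Ident C y}"

locale symmetric_monoidal_category =
  fixes C :: "('o, 'm) moncat" (structure)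
  assumes dom_obj: "f \<in> Arr C \<Longrightarrow> Dom C f \<in> Obj C"
    and cod_obj: "f \<in> Arr C \<Longrightarrow> Cod C f \<in> Obj C"
    and ident_hom: "x \<in> Obj C \<Longrightarrow> Ident C x \<in> homset C x x"
    and comp_hom: "\<lbrakk>f \<in> homset C x y; g \<in> homset C y z\<rbrakk> \<Longrightarrow> g \<odot> f \<in> homset C x z"
    and ident_left: "f \<in> homset C x y \<Longrightarrow> Ident C y \<odot> f = f"
    and ident_right: "f \<in> homset C x y \<Longrightarrow> f \<odot> Ident C x = f"
    and comp_assoc: "\<lbrakk>f \<in> homset C w x; g \<in> homset C x y; h \<in> homset C y z\<rbrakk>
          \<Longrightarrow> (h \<odot> g) \<odot> f = h \<odot> (g \<odot> f)"
    and unit_obj: "UnitO C \<in> Obj C"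
    and tensor_obj: "\<lbrakk>x \<in> Obj C; y \<in> Obj C\<rbrakk> \<Longrightarrow> x \<boxdot> y \<in> Obj C"
    and tensor_hom: "\<lbrakk>f \<in> homset C x x'; g \<in> homset C y y'\<rbrakk>
          \<Longrightarrow> f \<boxtimes> g \<in> homset C (x \<boxdot> y) (x' \<boxdot> y')"
    and tensor_ident: "\<lbrakk>x \<in> Obj C; y \<in> Obj C\<rbrakk> \<Longrightarrow> Ident C x \<boxtimes> Ident C y = Ident C (x \<boxdot> y)"
    and tensor_comp: "\<lbrakk>f \<in> homset C x x'; f' \<in> homset C x' x''; g \<in> homset C y y'; g' \<in> homset C y' y''\<rbrakk>
          \<Longrightarrow> (f' \<odot> f) \<boxtimes> (g' \<odot> g) = (f' \<boxtimes> g') \<odot> (f \<boxtimes> g)"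
    and assoc_iso: "\<lbrakk>x \<in> Obj C; y \<in> Obj C; z \<in> Obj C\<rbrakk>
          \<Longrightarrow> Assoc C x y z \<in> isos C ((x \<boxdot> y) \<boxdot> z) (x \<boxdot> (y \<boxdot> z))"
    and lunit_iso: "x \<in> Obj C \<Longrightarrow> LUnit C x \<in> isos C (UnitO C \<boxdot> x) x"
    and runit_iso: "x \<in> Obj C \<Longrightarrow> RUnit C x \<in> isos C (x \<boxdot> UnitO C) x"
    and braid_iso: "\<lbrakk>x \<in> Obj C; y \<in> Obj C\<rbrakk> \<Longrightarrow> Braid C x y \<in> isos C (x \<boxdot> y) (y \<boxdot> x)"
    and assoc_natural: "\<lbrakk>f \<in> homset C x x'; g \<in> homset C y y'; h \<in> homset C z z'\<rbrakk>
          \<Longrightarrow> Assoc C x' y' z' \<odot> ((f \<boxtimes> g) \<boxtimes> h) = (f \<boxtimes> (g \<boxtimes> h)) \<odot> Assoc C x y z"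
    and lunit_natural: "f \<in> homset C x y
          \<Longrightarrow> LUnit C y \<odot> (Ident C (UnitO C) \<boxtimes> f) = f \<odot> LUnit C x"
    and runit_natural: "f \<in> homset C x y
          \<Longrightarrow> RUnit C y \<odot> (f \<boxtimes> Ident C (UnitO C)) = f \<odot> RUnit C x"
    and braid_natural: "\<lbrakk>f \<in> homset C x x'; g \<in> homset C y y'\<rbrakk>
          \<Longrightarrow> Braid C x' y' \<odot> (f \<boxtimes> g) = (g \<boxtimes> f) \<odot> Braid C x y"
    and pentagon: "\<lbrakk>w \<in> Obj C; x \<in> Obj C; y \<in> Obj C; z \<in> Obj C\<rbrakk>
          \<Longrightarrow> Assoc C w x (y \<boxdot> z) \<odot> Assoc C (w \<boxdot> x) y z
              = (Ident C w \<boxtimes> Assoc C x y z) \<odot> Assoc C w (x \<boxdot> y) z \<odot> (Assoc C w x y \<boxtimes> Ident C z)"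
    and triangle: "\<lbrakk>x \<in> Obj C; y \<in> Obj C\<rbrakk>
          \<Longrightarrow> (Ident C x \<boxtimes> LUnit C y) \<odot> Assoc C x (UnitO C) y = RUnit C x \<boxtimes> Ident C y"
    and hexagon: "\<lbrakk>x \<in> Obj C; y \<in> Obj C; z \<in> Obj C\<rbrakk>
          \<Longrightarrow> Assoc C y z x \<odot> Braid C x (y \<boxdot> z) \<odot> Assoc C x y z
              = (Ident C y \<boxtimes> Braid C x z) \<odot> Assoc C y x z \<odot> (Braid C x y \<boxtimes> Ident C z)"
    and symmetry: "\<lbrakk>x \<in> Obj C; y \<in> Obj C\<rbrakk> \<Longrightarrow> Braid C y x \<odot> Braid C x y = Ident C (x \<boxdot> y)"

record ('o, 'm, 'p, 'q) monfun =
  FObj :: "'o \<Rightarrow> 'p"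
  FArr :: "'m \<Rightarrow> 'q"
  FMult :: "'o \<Rightarrow> 'o \<Rightarrow> 'q"
  FUnit :: "'q"

text \<open>Strong monoidal: \<open>FMult x y : F x \<otimes> F y \<rightarrow> F (x \<otimes> y)\<close> and \<open>FUnit : 1 \<rightarrow> F 1\<close> are isomorphisms.\<close>

locale symmetric_monoidal_functor =
  C: symmetric_monoidal_category C + D: symmetric_monoidal_category D
  for C :: "('o, 'm) moncat" and D :: "('p, 'q) moncat" and F :: "('o, 'm, 'p, 'q) monfun" +
  assumes obj: "x \<in> Obj C \<Longrightarrow> FObj F x \<in> Obj D"
    and arr: "f \<in> homset C x y \<Longrightarrow> FArr F f \<in> homset D (FObj F x) (FObj F y)"
    and ident: "x \<in> Obj C \<Longrightarrow> FArr F (Ident C x) = Ident D (FObj F x)"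
    and comp: "\<lbrakk>f \<in> homset C x y; g \<in> homset C y z\<rbrakk> \<Longrightarrow> FArr F (g \<odot>\<^bsub>C\<^esub> f) = FArr F g \<odot>\<^bsub>D\<^esub> FArr F f"
    and mult_iso: "\<lbrakk>x \<in> Obj C; y \<in> Obj C\<rbrakk>
          \<Longrightarrow> FMult F x y \<in> isos D (FObj F x \<boxdot>\<^bsub>D\<^esub> FObj F y) (FObj F (x \<boxdot>\<^bsub>C\<^esub> y))"
    and unit_iso: "FUnit F \<in> isos D (UnitO D) (FObj F (UnitO C))"
    and mult_natural: "\<lbrakk>f \<in> homset C x x'; g \<in> homset C y y'\<rbrakk>
          \<Longrightarrow> FArr F (f \<boxtimes>\<^bsub>C\<^esub> g) \<odot>\<^bsub>D\<^esub> FMult F x y = FMult F x' y' \<odot>\<^bsub>D\<^esub> (FArr F f \<boxtimes>\<^bsub>D\<^esub> FArr F g)"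
    and mult_assoc: "\<lbrakk>x \<in> Obj C; y \<in> Obj C; z \<in> Obj C\<rbrakk>
          \<Longrightarrow> FArr F (Assoc C x y z) \<odot>\<^bsub>D\<^esub> FMult F (x \<boxdot>\<^bsub>C\<^esub> y) z \<odot>\<^bsub>D\<^esub> (FMult F x y \<boxtimes>\<^bsub>D\<^esub> Ident D (FObj F z))
              = FMult F x (y \<boxdot>\<^bsub>C\<^esub> z) \<odot>\<^bsub>D\<^esub> (Ident D (FObj F x) \<boxtimes>\<^bsub>D\<^esub> FMult F y z)
                  \<odot>\<^bsub>D\<^esub> Assoc D (FObj F x) (FObj F y) (FObj F z)"
    and mult_lunit: "x \<in> Obj C
          \<Longrightarrow> FArr F (LUnit C x) \<odot>\<^bsub>D\<^esub> FMult F (UnitO C) x \<odot>\<^bsub>D\<^esub> (FUnit F \<boxtimes>\<^bsub>D\<^esub> Ident D (FObj F x))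
              = LUnit D (FObj F x)"
    and mult_runit: "x \<in> Obj C
          \<Longrightarrow> FArr F (RUnit C x) \<odot>\<^bsub>D\<^esub> FMult F x (UnitO C) \<odot>\<^bsub>D\<^esub> (Ident D (FObj F x) \<boxtimes>\<^bsub>D\<^esub> FUnit F)
              = RUnit D (FObj F x)"
    and mult_braid: "\<lbrakk>x \<in> Obj C; y \<in> Obj C\<rbrakk>
          \<Longrightarrow> FArr F (Braid C x y) \<odot>\<^bsub>D\<^esub> FMult F x y = FMult F y x \<odot>\<^bsub>D\<^esub> Braid D (FObj F x) (FObj F y)"


section \<open>The category \<open>Chain\<^sup>n\<^sup>+\<^sup>1(X)\<close>\<close>

text \<open>A morphism \<open>a : x \<rightarrow> x'\<close> is the triple \<open>(x, a, x')\<close>.\<close>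

definition chain_cat ::
  "nat \<Rightarrow> 'a diffeology \<Rightarrow> ('a chain, 'a chain \<times> 'a chain \<times> 'a chain) moncat" where
  "chain_cat n X =
    \<lparr> Obj = smooth_cycles X n,
      Arr = {(x, a, x'). x \<in> smooth_cycles X n \<and> x' \<in> smooth_cycles X n \<and>
               a \<in> smooth_chains X (n + 1) \<and> chain_boundary (n + 1) a = x' - x},
      Dom = (\<lambda>(x, a, x'). x),
      Cod = (\<lambda>(x, a, x'). x'),
      Ident = (\<lambda>x. (x, 0, x)),
      Comp = (\<lambda>(y, b, z) (x, a, y'). (x, a + b, z)),
      TensorO = (+),
      TensorA = (\<lambda>(x, a, x') (y, b, y'). (x + y, a + b, x' + y')),
      UnitO = 0,
      Assoc = (\<lambda>x y z. (x + y + z, 0, x + y + z)),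
      LUnit = (\<lambda>x. (x, 0, x)),
      RUnit = (\<lambda>x. (x, 0, x)),
      Braid = (\<lambda>x y. (x + y, 0, x + y)) \<rparr>"


section \<open>Hermitian lines\<close>

record 'e hline =
  vecs :: "'e set"
  vzero :: 'e
  vplus :: "'e \<Rightarrow> 'e \<Rightarrow> 'e"
  vscale :: "complex \<Rightarrow> 'e \<Rightarrow> 'e"
  herm :: "'e \<Rightarrow> 'e \<Rightarrow> complex"

locale hermitian_line =
  fixes L :: "'e hline"
  assumes zero_in: "vzero L \<in> vecs L"
    and plus_in: "\<lbrakk>u \<in> vecs L; v \<in> vecs L\<rbrakk> \<Longrightarrow> vplus L u v \<in> vecs L"
    and scale_in: "u \<in> vecs L \<Longrightarrow> vscale L c u \<in> vecs L"
    and plus_assoc: "\<lbrakk>u \<in> vecs L; v \<in> vecs L; w \<in> vecs L\<rbrakk>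
          \<Longrightarrow> vplus L (vplus L u v) w = vplus L u (vplus L v w)"
    and plus_commute: "\<lbrakk>u \<in> vecs L; v \<in> vecs L\<rbrakk> \<Longrightarrow> vplus L u v = vplus L v u"
    and plus_zero: "u \<in> vecs L \<Longrightarrow> vplus L u (vzero L) = u"
    and plus_minus: "u \<in> vecs L \<Longrightarrow> vplus L u (vscale L (-1) u) = vzero L"
    and scale_plus: "\<lbrakk>u \<in> vecs L; v \<in> vecs L\<rbrakk>
          \<Longrightarrow> vscale L c (vplus L u v) = vplus L (vscale L c u) (vscale L c v)"
    and plus_scale: "u \<in> vecs L \<Longrightarrow> vscale L (c + d) u = vplus L (vscale L c u) (vscale L d u)"
    and scale_scale: "u \<in> vecs L \<Longrightarrow> vscale L c (vscale L d u) = vscale L (c * d) u"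
    and scale_one: "u \<in> vecs L \<Longrightarrow> vscale L 1 u = u"
    and dim_one: "\<exists>e\<in>vecs L. e \<noteq> vzero L \<and> (\<forall>v\<in>vecs L. \<exists>c. v = vscale L c e)"
    and herm_plus: "\<lbrakk>u \<in> vecs L; v \<in> vecs L; w \<in> vecs L\<rbrakk>
          \<Longrightarrow> herm L (vplus L u v) w = herm L u w + herm L v w"
    and herm_scale: "\<lbrakk>u \<in> vecs L; v \<in> vecs L\<rbrakk> \<Longrightarrow> herm L (vscale L c u) v = c * herm L u v"
    and herm_sym: "\<lbrakk>u \<in> vecs L; v \<in> vecs L\<rbrakk> \<Longrightarrow> herm L v u = cnj (herm L u v)"
    and herm_pos: "\<lbrakk>u \<in> vecs L; u \<noteq> vzero L\<rbrakk> \<Longrightarrow> 0 < Re (herm L u u)"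

text \<open>On lines, linear isometries are automatically bijective.\<close>

definition line_isometry :: "'e hline \<Rightarrow> 'e hline \<Rightarrow> ('e \<Rightarrow> 'e) \<Rightarrow> bool" where
  "line_isometry L M f \<longleftrightarrow> f \<in> vecs L \<rightarrow>\<^sub>E vecs M \<and>
     (\<forall>u\<in>vecs L. \<forall>v\<in>vecs L. f (vplus L u v) = vplus M (f u) (f v)) \<and>
     (\<forall>c. \<forall>u\<in>vecs L. f (vscale L c u) = vscale M c (f u)) \<and>
     (\<forall>u\<in>vecs L. \<forall>v\<in>vecs L. herm M (f u) (f v) = herm L u v)"

text \<open>
  A type of vectors that contains the scalars and is closed under forming tensors, over an
  arbitrary type \<^typ>\<open>'v\<close> of basic vectors.  It makes the lines with vectors in it into a
  symmetric monoidal category.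
\<close>

datatype 'v vec = Basic 'v | Scalar (scalar_of: complex) | Tensor "'v vec" "'v vec"

definition complex_line :: "'v vec hline" where
  "complex_line =
    \<lparr> vecs = range Scalar,
      vzero = Scalar 0,
      vplus = (\<lambda>u v. Scalar (scalar_of u + scalar_of v)),
      vscale = (\<lambda>c u. Scalar (c * scalar_of u)),
      herm = (\<lambda>u v. scalar_of u * cnj (scalar_of v)) \<rparr>"

definition bilinear_form :: "'e hline \<Rightarrow> 'e hline \<Rightarrow> ('e \<Rightarrow> 'e \<Rightarrow> complex) \<Rightarrow> bool" where
  "bilinear_form L M B \<longleftrightarrow>
     (\<forall>u\<in>vecs L. \<forall>u'\<in>vecs L. \<forall>v\<in>vecs M. B (vplus L u u') v = B u v + B u' v) \<and>
     (\<forall>u\<in>vecs L. \<forall>v\<in>vecs M. \<forall>v'\<in>vecs M. B u (vplus M v v') = B u v + B u v') \<and>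
     (\<forall>c. \<forall>u\<in>vecs L. \<forall>v\<in>vecs M. B (vscale L c u) v = c * B u v \<and> B u (vscale M c v) = c * B u v)"

text \<open>
  \<open>tens L M u v\<close> is \<open>u \<otimes> v \<in> L \<otimes> M\<close>.  Two pairs define the same tensor iff all bilinear forms agree
  on them, and each class of pairs is represented by a chosen member.  Every element of a tensor
  product of lines is of the form \<open>u \<otimes> v\<close>.
\<close>

definition tens :: "'v vec hline \<Rightarrow> 'v vec hline \<Rightarrow> 'v vec \<Rightarrow> 'v vec \<Rightarrow> 'v vec" where
  "tens L M u v =
     (SOME p. \<exists>u'\<in>vecs L. \<exists>v'\<in>vecs M. p = Tensor u' v' \<and>
        (\<forall>B. bilinear_form L M B \<longrightarrow> B u' v' = B u v))"

fun on_tensor :: "('v vec \<Rightarrow> 'v vec \<Rightarrow> 'b) \<Rightarrow> 'v vec \<Rightarrow> 'b" where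
  "on_tensor \<beta> (Tensor u v) = \<beta> u v"
| "on_tensor \<beta> _ = undefined"

definition tensor_vecs :: "'v vec hline \<Rightarrow> 'v vec hline \<Rightarrow> 'v vec set" where
  "tensor_vecs L M = {tens L M u v | u v. u \<in> vecs L \<and> v \<in> vecs M}"

definition tensor_line :: "'v vec hline \<Rightarrow> 'v vec hline \<Rightarrow> 'v vec hline" where
  "tensor_line L M =
    \<lparr> vecs = tensor_vecs L M,
      vzero = tens L M (vzero L) (vzero M),
      vplus = (\<lambda>p q. THE r. r \<in> tensor_vecs L M \<and>
                (\<forall>B. bilinear_form L M B \<longrightarrow> on_tensor B r = on_tensor B p + on_tensor B q)),
      vscale = (\<lambda>c p. THE r. r \<in> tensor_vecs L M \<and>
                (\<forall>B. bilinear_form L M B \<longrightarrow> on_tensor B r = c * on_tensor B p)),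
      herm = (\<lambda>p q. on_tensor (\<lambda>u v. on_tensor (\<lambda>u' v'. herm L u u' * herm M v v') q) p) \<rparr>"

type_synonym 'e line_map = "'e hline \<times> ('e \<Rightarrow> 'e) \<times> 'e hline"

text \<open>The structure maps are given on elementary tensors by \<open>(u \<otimes> v) \<otimes> w \<mapsto> u \<otimes> (v \<otimes> w)\<close>,
  \<open>c \<otimes> u \<mapsto> c u\<close>, \<open>u \<otimes> c \<mapsto> c u\<close> and \<open>u \<otimes> v \<mapsto> v \<otimes> u\<close>.\<close>

definition lines :: "('v vec hline, 'v vec line_map) moncat" where
  "lines =
    \<lparr> Obj = Collect hermitian_line,
      Arr = {(L, f, M). hermitian_line L \<and> hermitian_line M \<and> line_isometry L M f},
      Dom = (\<lambda>(L, f, M). L),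
      Cod = (\<lambda>(L, f, M). M),
      Ident = (\<lambda>L. (L, \<lambda>u\<in>vecs L. u, L)),
      Comp = (\<lambda>(M, g, N) (L, f, M'). (L, compose (vecs L) g f, N)),
      TensorO = tensor_line,
      TensorA = (\<lambda>(L, f, L') (M, g, M').
        (tensor_line L M,
         \<lambda>p\<in>vecs (tensor_line L M). on_tensor (\<lambda>u v. tens L' M' (f u) (g v)) p,
         tensor_line L' M')),
      UnitO = complex_line,
      Assoc = (\<lambda>L M N.
        (tensor_line (tensor_line L M) N,
         \<lambda>p\<in>vecs (tensor_line (tensor_line L M) N).
           on_tensor (\<lambda>q w. on_tensor (\<lambda>u v. tens L (tensor_line M N) u (tens M N v w)) q) p,
         tensor_line L (tensor_line M N))),
      LUnit = (\<lambda>L.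
        (tensor_line complex_line L,
         \<lambda>p\<in>vecs (tensor_line complex_line L). on_tensor (\<lambda>c u. vscale L (scalar_of c) u) p,
         L)),
      RUnit = (\<lambda>L.
        (tensor_line L complex_line,
         \<lambda>p\<in>vecs (tensor_line L complex_line). on_tensor (\<lambda>u c. vscale L (scalar_of c) u) p,
         L)),
      Braid = (\<lambda>L M.
        (tensor_line L M,
         \<lambda>p\<in>vecs (tensor_line L M). on_tensor (\<lambda>u v. tens M L v u) p,
         tensor_line M L)) \<rparr>"


section \<open>Chain field theories\<close>

definition scalar_map :: "complex \<Rightarrow> 'v vec line_map" where
  "scalar_map c = (complex_line, \<lambda>u\<in>vecs complex_line. vscale complex_line c u, complex_line)"

text \<open>\<open>E(\<partial>b) \<in> Aut(E(0))\<close> is identified with a complex number along \<open>FUnit E : \<complex> \<rightarrow> E(0)\<close>.\<close>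

locale chain_field_theory =
  symmetric_monoidal_functor "chain_cat n X" lines E
  for n :: nat and X :: "'a diffeology"
    and E :: "('a chain, 'a chain \<times> 'a chain \<times> 'a chain, 'v vec hline, 'v vec line_map) monfun" +
  assumes smoothness: "\<exists>\<omega>. closed_form X (n + 2) \<omega> \<and>
    (\<forall>b\<in>smooth_chains X (n + 2).
       FArr E (0, chain_boundary (n + 2) b, 0) \<odot>\<^bsub>lines\<^esub> FUnit E
       = FUnit E \<odot>\<^bsub>lines\<^esub> scalar_map (exp (2 * of_real pi * \<i> * of_real (chain_integral (n + 2) \<omega> b))))"


section \<open>\<open>Chain\<^sup>n\<^sup>+\<^sup>1(X)\<close> and the Hermitian lines are symmetric monoidal categories\<close>

lemma smooth_chains_0 [simp]: "0 \<in> smooth_chains X p"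
  by (simp add: smooth_chains_def)

lemma smooth_chains_add: "\<lbrakk>a \<in> smooth_chains X p; b \<in> smooth_chains X p\<rbrakk> \<Longrightarrow> a + b \<in> smooth_chains X p"
  using keys_add[of a b] by (auto simp: smooth_chains_def)

lemma smooth_cycles_add: "\<lbrakk>a \<in> smooth_cycles X p; b \<in> smooth_cycles X p\<rbrakk> \<Longrightarrow> a + b \<in> smooth_cycles X p"
  by (auto simp: smooth_cycles_def smooth_chains_add chain_boundary_add)

lemma smooth_cycles_0 [simp]: "0 \<in> smooth_cycles X p"
  by (simp add: smooth_cycles_def)

lemma smooth_cycles_add': "\<lbrakk>a + c \<in> smooth_cycles X p; b + d \<in> smooth_cycles X p\<rbrakk> \<Longrightarrow> a + (b + (c + d)) \<in> smooth_cycles X p"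
  using smooth_cycles_add[of "a + c" X p "b + d"] by (simp add: algebra_simps)

lemma chain_cat_symmetric_monoidal: "symmetric_monoidal_category (chain_cat n X)"
  by (unfold_locales;
      auto simp: chain_cat_def homset_def isos_def smooth_cycles_add smooth_cycles_add' smooth_chains_add
        chain_boundary_add algebra_simps)

text \<open>\<open>coord L \<phi>\<close>: \<open>\<phi>\<close> is a unitary isomorphism \<open>L \<rightarrow> \<complex>\<close>.\<close>

definition coord :: "'e hline \<Rightarrow> ('e \<Rightarrow> complex) \<Rightarrow> bool" where
  "coord L \<phi> \<longleftrightarrow> bij_betw \<phi> (vecs L) UNIV \<and> vzero L \<in> vecs L \<and> \<phi> (vzero L) = 0 \<and>
     (\<forall>u\<in>vecs L. \<forall>v\<in>vecs L. vplus L u v \<in> vecs L \<and> \<phi> (vplus L u v) = \<phi> u + \<phi> v \<and>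
        herm L u v = \<phi> u * cnj (\<phi> v)) \<and>
     (\<forall>c. \<forall>u\<in>vecs L. vscale L c u \<in> vecs L \<and> \<phi> (vscale L c u) = c * \<phi> u)"

lemma coord_inj: "\<lbrakk>coord L \<phi>; u \<in> vecs L; v \<in> vecs L; \<phi> u = \<phi> v\<rbrakk> \<Longrightarrow> u = v"
  by (auto simp: coord_def bij_betw_def inj_on_def)

lemma coord_surj: "coord L \<phi> \<Longrightarrow> \<exists>u\<in>vecs L. \<phi> u = c"
  by (metis UNIV_I bij_betw_imp_surj_on coord_def image_iff)

lemma coord_line: assumes "coord L \<phi>" shows "hermitian_line L"
proof -
  note inj = coord_inj[OF assms]
  obtain e where e: "e \<in> vecs L" "\<phi> e = 1" using coord_surj[OF assms] by blast
  have d: "\<exists>e\<in>vecs L. e \<noteq> vzero L \<and> (\<forall>v\<in>vecs L. \<exists>c. v = vscale L c e)"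
  proof (rule bexI[OF _ e(1)], safe)
    assume "e = vzero L" then show False using e assms by (auto simp: coord_def)
  next
    fix v assume "v \<in> vecs L"
    then have "v = vscale L (\<phi> v) e" using e assms by (intro inj) (auto simp: coord_def)
    then show "\<exists>c. v = vscale L c e" by blast
  qed
  have pos: "0 < Re (herm L u u)" if "u \<in> vecs L" "u \<noteq> vzero L" for u
  proof -
    have "\<phi> u \<noteq> 0" using that assms inj[of u "vzero L"] by (auto simp: coord_def)
    moreover have "herm L u u = \<phi> u * cnj (\<phi> u)" using that assms by (auto simp: coord_def)
    ultimately show ?thesis by (simp add: complex_neq_0 power2_eq_square)
  qed
  show ?thesis
    apply unfold_locales
    using assms d pos
    apply (simp_all add: coord_def)
    apply (intro inj; simp add: coord_def algebra_simps)+
    apply (simp_all add: algebra_simps)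
    done
qed

lemma line_coord: assumes "hermitian_line L" shows "\<exists>\<phi>. coord L \<phi>"
proof -
  interpret hermitian_line L by fact
  obtain e0 where e0: "e0 \<in> vecs L" "e0 \<noteq> vzero L" and gen0: "\<And>v. v \<in> vecs L \<Longrightarrow> \<exists>c. v = vscale L c e0"
    using dim_one by blast
  have s0: "vscale L 0 u = vzero L" if "u \<in> vecs L" for u
    using plus_scale[OF that, of 1 "-1"] plus_minus[OF that] scale_one[OF that] by simp
  define r where "r = Re (herm L e0 e0)"
  have r: "0 < r" using herm_pos e0 by (simp add: r_def)
  have rr: "herm L e0 e0 = of_real r" using arg_cong[OF herm_sym[OF e0(1) e0(1)], of Im]
    by (simp add: r_def complex_eq_iff)
  define s :: complex where "s = of_real (1 / sqrt r)"
  define e where "e = vscale L s e0"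
  have e: "e \<in> vecs L" by (simp add: e_def scale_in e0)
  have h2: "herm L u (vscale L c v) = cnj c * herm L u v" if "u \<in> vecs L" "v \<in> vecs L" for u v c
    using that herm_sym[of "vscale L c v" u] herm_scale[of v u c] herm_sym[of v u] scale_in[of v c]
    by simp
  have "herm L e e = s * (cnj s * of_real r)"
    by (simp add: e_def herm_scale h2 e0 scale_in rr)
  also have "\<dots> = of_real ((1 / sqrt r) * (1 / sqrt r) * r)" by (simp only: s_def complex_cnj_complex_of_real of_real_mult mult.assoc)
  also have "(1 / sqrt r) * (1 / sqrt r) * r = 1" using r by (simp add: field_simps)
  finally have he: "herm L e e = 1" by simp
  have gen: "\<exists>c. v = vscale L c e" if v: "v \<in> vecs L" for v
  proof -
    obtain c where "v = vscale L c e0" using gen0 v by blast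
    then have "v = vscale L (c * of_real (sqrt r)) e"
      using r e0 by (simp add: e_def s_def scale_scale)
    then show ?thesis by blast
  qed
  define \<phi> where "\<phi> v = herm L v e" for v
  have \<phi>e: "\<phi> (vscale L c e) = c" for c by (simp add: \<phi>_def herm_scale e he)
  have rep: "v = vscale L (\<phi> v) e" if "v \<in> vecs L" for v using gen[OF that] \<phi>e by metis
  have "bij_betw \<phi> (vecs L) UNIV"
    by (rule bij_betwI[where g = "\<lambda>c. vscale L c e"]) (use rep \<phi>e scale_in e in auto)
  moreover have "herm L u v = \<phi> u * cnj (\<phi> v)" if "u \<in> vecs L" "v \<in> vecs L" for u v
  proof -
    have "herm L u v = herm L u (vscale L (\<phi> v) e)" using rep that by simp
    also have "\<dots> = cnj (\<phi> v) * \<phi> u" using h2[OF that(1) e] by (simp add: \<phi>_def)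
    finally show ?thesis by simp
  qed
  moreover have "\<phi> (vzero L) = 0" using \<phi>e[of 0] s0[OF e] by simp
  moreover have "\<phi> (vplus L u v) = \<phi> u + \<phi> v" if "u \<in> vecs L" "v \<in> vecs L" for u v
    using that e by (simp add: \<phi>_def herm_plus)
  moreover have "\<phi> (vscale L c u) = c * \<phi> u" if "u \<in> vecs L" for c u
    using that e by (simp add: \<phi>_def herm_scale)
  ultimately have "coord L \<phi>"
    unfolding coord_def by (intro conjI ballI allI zero_in plus_in scale_in)
  then show ?thesis by blast
qed

text \<open>Chosen coordinates on every line; isometries are multiplication by a unit in them, and those on
  \<open>L \<otimes> M\<close> differ by a unit \<open>cw L M\<close> from the product of those on \<open>L\<close> and \<open>M\<close>.\<close>

definition cf :: "'e hline \<Rightarrow> 'e \<Rightarrow> complex" where "cf L = (SOME \<phi>. coord L \<phi>)"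

lemma coord_cf: "hermitian_line L \<Longrightarrow> coord L (cf L)"
  unfolding cf_def using line_coord by (rule someI_ex)

lemma cf_simps:
  assumes "hermitian_line L" "u \<in> vecs L" "v \<in> vecs L"
  shows "cf L (vplus L u v) = cf L u + cf L v" "cf L (vscale L c u) = c * cf L u"
    "herm L u v = cf L u * cnj (cf L v)" "vplus L u v \<in> vecs L" "vscale L c u \<in> vecs L"
  using coord_cf[OF assms(1)] assms by (auto simp: coord_def)

lemma cf_scale: "\<lbrakk>hermitian_line L; u \<in> vecs L\<rbrakk> \<Longrightarrow> vscale L c u \<in> vecs L \<and> cf L (vscale L c u) = c * cf L u"
  using cf_simps(2,5)[of L u u] by simp

lemma cf_zero: "hermitian_line L \<Longrightarrow> vzero L \<in> vecs L \<and> cf L (vzero L) = 0"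
  using coord_cf[of L] by (auto simp: coord_def)

lemma cf_inj: "\<lbrakk>hermitian_line L; u \<in> vecs L; v \<in> vecs L; cf L u = cf L v\<rbrakk> \<Longrightarrow> u = v"
  by (rule coord_inj[OF coord_cf])

lemma bilinear_cf: assumes "hermitian_line L" "hermitian_line M"
  shows "bilinear_form L M (\<lambda>u v. cf L u * cf M v)"
  using assms by (simp add: bilinear_form_def cf_simps algebra_simps)

lemma bilinear_eq:
  assumes L: "hermitian_line L" and M: "hermitian_line M" and B: "bilinear_form L M B"
  shows "\<exists>k. \<forall>u\<in>vecs L. \<forall>v\<in>vecs M. B u v = k * (cf L u * cf M v)"
proof -
  obtain e where e: "e \<in> vecs L" "cf L e = 1" using coord_surj[OF coord_cf[OF L]] by blast
  obtain f where f: "f \<in> vecs M" "cf M f = 1" using coord_surj[OF coord_cf[OF M]] by blast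
  have "B u v = B e f * (cf L u * cf M v)" if "u \<in> vecs L" "v \<in> vecs M" for u v
  proof -
    have "u = vscale L (cf L u) e" using that e by (intro cf_inj[OF L]) (auto simp: cf_simps L)
    moreover have "v = vscale M (cf M v) f" using that f by (intro cf_inj[OF M]) (auto simp: cf_simps M)
    ultimately have "B u v = B (vscale L (cf L u) e) (vscale M (cf M v) f)" by simp
    also have "\<dots> = cf L u * (cf M v * B e f)"
      using B that e f cf_simps[OF M f(1) f(1)] by (simp add: bilinear_form_def)
    finally show ?thesis by simp
  qed
  then show ?thesis by blast
qed

lemma tens_rep:
  assumes "u \<in> vecs L" "v \<in> vecs M"
  shows "\<exists>u'\<in>vecs L. \<exists>v'\<in>vecs M. tens L M u v = Tensor u' v' \<and>
        (\<forall>B. bilinear_form L M B \<longrightarrow> B u' v' = B u v)"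
proof -
  have "\<exists>p. \<exists>u'\<in>vecs L. \<exists>v'\<in>vecs M. p = Tensor u' v' \<and> (\<forall>B. bilinear_form L M B \<longrightarrow> B u' v' = B u v)"
    using assms by blast
  from someI_ex[OF this] show ?thesis by (simp add: tens_def)
qed

lemma tens_eq:
  assumes "hermitian_line L" "hermitian_line M"
    "u \<in> vecs L" "v \<in> vecs M" "u' \<in> vecs L" "v' \<in> vecs M" "cf L u * cf M v = cf L u' * cf M v'"
  shows "tens L M u v = tens L M u' v'"
proof -
  have "B u v = B u' v'" if "bilinear_form L M B" for B
    using bilinear_eq[OF assms(1,2) that] assms by auto
  then have "(\<forall>B. bilinear_form L M B \<longrightarrow> B x y = B u v) \<longleftrightarrow> (\<forall>B. bilinear_form L M B \<longrightarrow> B x y = B u' v')" for x y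
    by metis
  then show ?thesis by (simp only: tens_def)
qed

lemma on_tensor_bil: "\<lbrakk>bilinear_form L M B; u \<in> vecs L; v \<in> vecs M\<rbrakk> \<Longrightarrow> on_tensor B (tens L M u v) = B u v"
  using tens_rep[of u L v M] by auto

lemma on_tensor_map:
  assumes "hermitian_line L" "hermitian_line M" "hermitian_line N"
    and "\<And>u v. \<lbrakk>u \<in> vecs L; v \<in> vecs M\<rbrakk> \<Longrightarrow> \<beta> u v \<in> vecs N \<and> cf N (\<beta> u v) = k * (cf L u * cf M v)"
    and "u \<in> vecs L" "v \<in> vecs M"
  shows "on_tensor \<beta> (tens L M u v) = \<beta> u v"
proof -
  obtain u' v' where *: "u' \<in> vecs L" "v' \<in> vecs M" "tens L M u v = Tensor u' v'"
     "\<forall>B. bilinear_form L M B \<longrightarrow> B u' v' = B u v" using tens_rep[OF assms(5,6)] by blast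
  then have "cf L u' * cf M v' = cf L u * cf M v" using bilinear_cf[OF assms(1,2)] by blast
  then have "\<beta> u' v' = \<beta> u v" using assms * by (intro cf_inj[OF assms(3)]) auto
  then show ?thesis using * by simp
qed

lemma tensor_coord:
  assumes L: "hermitian_line L" and M: "hermitian_line M"
  shows "coord (tensor_line L M) (on_tensor (\<lambda>u v. cf L u * cf M v))" (is "coord ?T ?t")
proof -
  note b = bilinear_cf[OF L M]
  note t = on_tensor_bil[OF b]
  have ex: "\<exists>p\<in>tensor_vecs L M. ?t p = c" for c
  proof -
    obtain e where e: "e \<in> vecs L" "cf L e = c" using coord_surj[OF coord_cf[OF L]] by blast
    obtain f where f: "f \<in> vecs M" "cf M f = 1" using coord_surj[OF coord_cf[OF M]] by blast
    show ?thesis by (rule bexI[of _ "tens L M e f"]) (use e f t in \<open>auto simp: tensor_vecs_def\<close>)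
  qed
  have inj: "p = q" if pq: "p \<in> tensor_vecs L M" "q \<in> tensor_vecs L M" "?t p = ?t q" for p q
  proof -
    from pq obtain u v u' v' where *: "u \<in> vecs L" "v \<in> vecs M" "u' \<in> vecs L" "v' \<in> vecs M"
      "p = tens L M u v" "q = tens L M u' v'" by (auto simp: tensor_vecs_def)
    show ?thesis unfolding *(5,6)
      by (rule tens_eq[OF L M *(1-4)]) (use pq(3) * t in simp)
  qed
  have det: "\<exists>k. \<forall>p\<in>tensor_vecs L M. on_tensor B p = k * ?t p" if B: "bilinear_form L M B" for B
  proof -
    obtain k where k: "\<And>u v. u \<in> vecs L \<Longrightarrow> v \<in> vecs M \<Longrightarrow> B u v = k * (cf L u * cf M v)"
      using bilinear_eq[OF L M B] by blast
    have "on_tensor B p = k * ?t p" if "p \<in> tensor_vecs L M" for p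
      using that k t on_tensor_bil[OF B] by (auto simp: tensor_vecs_def)
    then show ?thesis by blast
  qed
  have the: "(THE r. r \<in> tensor_vecs L M \<and> (\<forall>B. bilinear_form L M B \<longrightarrow> on_tensor B r = F B)) = r"
    if "r \<in> tensor_vecs L M" "\<And>B. bilinear_form L M B \<Longrightarrow> on_tensor B r = F B" for r F
    by (rule the_equality) (use that inj b in \<open>auto\<close>)
  have plus: "vplus ?T p q \<in> vecs ?T \<and> ?t (vplus ?T p q) = ?t p + ?t q" if "p \<in> vecs ?T" "q \<in> vecs ?T" for p q
  proof -
    from that have pq: "p \<in> tensor_vecs L M" "q \<in> tensor_vecs L M" by (auto simp: tensor_line_def)
    obtain r where r: "r \<in> tensor_vecs L M" "?t r = ?t p + ?t q" using ex by blast
    have "vplus ?T p q = r" unfolding tensor_line_def hline.simps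
    proof (rule the[OF r(1)])
      fix B assume "bilinear_form L M B"
      from det[OF this] r pq show "on_tensor B r = on_tensor B p + on_tensor B q"
        by (auto simp: algebra_simps)
    qed
    with r show ?thesis by (simp add: tensor_line_def)
  qed
  have scale: "vscale ?T c p \<in> vecs ?T \<and> ?t (vscale ?T c p) = c * ?t p" if "p \<in> vecs ?T" for c p
  proof -
    from that have pq: "p \<in> tensor_vecs L M" by (auto simp: tensor_line_def)
    obtain r where r: "r \<in> tensor_vecs L M" "?t r = c * ?t p" using ex by blast
    have "vscale ?T c p = r" unfolding tensor_line_def hline.simps
    proof (rule the[OF r(1)])
      fix B assume "bilinear_form L M B"
      from det[OF this] r pq show "on_tensor B r = c * on_tensor B p"
        by (auto simp: algebra_simps)
    qed
    with r show ?thesis by (simp add: tensor_line_def)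
  qed
  have herm: "herm ?T p q = ?t p * cnj (?t q)" if "p \<in> vecs ?T" "q \<in> vecs ?T" for p q
  proof -
    from that obtain u v u' v' where *: "u \<in> vecs L" "v \<in> vecs M" "u' \<in> vecs L" "v' \<in> vecs M"
      "p = tens L M u v" "q = tens L M u' v'" by (auto simp: tensor_line_def tensor_vecs_def)
    obtain a b c d where "a \<in> vecs L" "b \<in> vecs M" "c \<in> vecs L" "d \<in> vecs M" "p = Tensor a b" "q = Tensor c d"
      using tens_rep[OF *(1,2)] tens_rep[OF *(3,4)] * by metis
    then show ?thesis by (simp add: tensor_line_def cf_simps L M)
  qed
  have "bij_betw ?t (vecs ?T) UNIV"
  proof (rule bij_betwI')
    show "?t p = ?t q \<longleftrightarrow> p = q" if "p \<in> vecs ?T" "q \<in> vecs ?T" for p q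
      using that inj[of p q] by (auto simp: tensor_line_def)
    show "\<exists>p\<in>vecs ?T. c = ?t p" for c using ex[of c] by (auto simp: tensor_line_def)
  qed simp
  moreover have "vzero ?T \<in> vecs ?T" "?t (vzero ?T) = 0"
    using cf_zero[OF L] cf_zero[OF M] t[of "vzero L" "vzero M"] by (auto simp: tensor_line_def tensor_vecs_def)
  ultimately show ?thesis using plus scale herm by (simp add: coord_def)
qed

lemma tensor_is_line: "\<lbrakk>hermitian_line L; hermitian_line M\<rbrakk> \<Longrightarrow> hermitian_line (tensor_line L M)"
  by (rule coord_line[OF tensor_coord])

lemma complex_coord: "coord complex_line scalar_of"
  by (auto simp: coord_def complex_line_def bij_betw_def inj_on_def image_def)

lemma complex_is_line: "hermitian_line complex_line"
  by (rule coord_line[OF complex_coord])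

lemma cmod_unit: assumes "z * cnj z = 1" shows "cmod z = 1"
proof -
  have "cmod z * cmod z = 1" using arg_cong[OF assms, of cmod] by (simp add: norm_mult)
  then show ?thesis by (metis abs_norm_cancel abs_square_eq_1 power2_eq_square)
qed

lemma coord_unique:
  assumes "coord L \<phi>" "coord L \<psi>"
  shows "\<exists>k. cmod k = 1 \<and> (\<forall>u\<in>vecs L. \<psi> u = k * \<phi> u)"
proof -
  obtain e where e: "e \<in> vecs L" "\<phi> e = 1" using coord_surj[OF assms(1)] by blast
  have "\<psi> u = \<psi> e * \<phi> u" if "u \<in> vecs L" for u
  proof -
    have "u = vscale L (\<phi> u) e" using assms e that by (intro coord_inj[OF assms(1)]) (auto simp: coord_def)
    then have "\<psi> u = \<psi> (vscale L (\<phi> u) e)" by simp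
    then show ?thesis using assms(2) e by (simp add: coord_def)
  qed
  moreover have "cmod (\<psi> e) = 1"
  proof -
    have "herm L e e = \<psi> e * cnj (\<psi> e)" "herm L e e = \<phi> e * cnj (\<phi> e)" using assms e(1) by (auto simp: coord_def)
    then have "\<psi> e * cnj (\<psi> e) = 1" using e by simp
    then show ?thesis by (rule cmod_unit)
  qed
  ultimately show ?thesis by blast
qed

lemma cf_tens:
  assumes "hermitian_line L" "hermitian_line M"
  shows "\<exists>k. cmod k = 1 \<and> (\<forall>u\<in>vecs L. \<forall>v\<in>vecs M. cf (tensor_line L M) (tens L M u v) = k * (cf L u * cf M v))"
proof -
  obtain k where k: "cmod k = 1" "\<forall>p\<in>vecs (tensor_line L M). cf (tensor_line L M) p = k * on_tensor (\<lambda>u v. cf L u * cf M v) p"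
    using coord_unique[OF tensor_coord[OF assms] coord_cf[OF tensor_is_line[OF assms]]] by blast
  have "cf (tensor_line L M) (tens L M u v) = k * (cf L u * cf M v)" if "u \<in> vecs L" "v \<in> vecs M" for u v
  proof -
    have "tens L M u v \<in> vecs (tensor_line L M)" using that by (auto simp: tensor_line_def tensor_vecs_def)
    then show ?thesis using k on_tensor_bil[OF bilinear_cf[OF assms] that] by simp
  qed
  with k show ?thesis by blast
qed

lemma tens_in [simp, intro]: "\<lbrakk>u \<in> vecs L; v \<in> vecs M\<rbrakk> \<Longrightarrow> tens L M u v \<in> vecs (tensor_line L M)"
  by (auto simp: tensor_line_def tensor_vecs_def)

lemma tens_cases:
  assumes "p \<in> vecs (tensor_line L M)"
  obtains u v where "u \<in> vecs L" "v \<in> vecs M" "p = tens L M u v"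
  using assms by (auto simp: tensor_line_def tensor_vecs_def)

lemma isometry_iff:
  assumes L: "hermitian_line L" and M: "hermitian_line M"
  shows "line_isometry L M f \<longleftrightarrow> f \<in> vecs L \<rightarrow>\<^sub>E vecs M \<and> (\<exists>k. cmod k = 1 \<and> (\<forall>u\<in>vecs L. cf M (f u) = k * cf L u))"
    (is "?l \<longleftrightarrow> ?r")
proof
  assume l: ?l
  then have ty: "f u \<in> vecs M" if "u \<in> vecs L" for u using that by (auto simp: line_isometry_def)
  obtain e where e: "e \<in> vecs L" "cf L e = 1" using coord_surj[OF coord_cf[OF L]] by blast
  have "cf M (f u) = cf M (f e) * cf L u" if "u \<in> vecs L" for u
  proof -
    have "u = vscale L (cf L u) e" using that e by (intro cf_inj[OF L]) (auto simp: cf_simps L)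
    then have "f u = vscale M (cf L u) (f e)" using l e by (metis line_isometry_def)
    then show ?thesis using ty[OF e(1)] by (simp add: cf_simps M)
  qed
  moreover have "cmod (cf M (f e)) = 1"
  proof -
    have "cf M (f e) * cnj (cf M (f e)) = 1" using l e ty[OF e(1)]
        cf_simps(3)[OF M ty[OF e(1)] ty[OF e(1)]] cf_simps(3)[OF L e(1) e(1)]
      by (simp add: line_isometry_def)
    then show ?thesis by (rule cmod_unit)
  qed
  ultimately show ?r using l by (auto simp: line_isometry_def)
next
  assume r: ?r
  then obtain k where k: "cmod k = 1" "\<And>u. u \<in> vecs L \<Longrightarrow> cf M (f u) = k * cf L u" by blast
  have ty: "f u \<in> vecs M" if "u \<in> vecs L" for u using that r by auto
  have kk: "k * cnj k = 1" using k(1) complex_norm_square[of k] by simp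
  show ?l unfolding line_isometry_def
  proof (intro conjI ballI allI)
    show "f \<in> vecs L \<rightarrow>\<^sub>E vecs M" using r by blast
    fix u v assume uv: "u \<in> vecs L" "v \<in> vecs L"
    show "f (vplus L u v) = vplus M (f u) (f v)"
      using uv ty by (intro cf_inj[OF M]) (auto simp: cf_simps L M k algebra_simps)
    have "herm M (f u) (f v) = (k * cnj k) * (cf L u * cnj (cf L v))"
      using uv ty by (simp add: cf_simps M k algebra_simps)
    then show "herm M (f u) (f v) = herm L u v" using uv kk by (simp add: cf_simps L)
  next
    fix c u assume uv: "u \<in> vecs L"
    show "f (vscale L c u) = vscale M c (f u)"
      using uv ty cf_simps[OF L uv uv] cf_simps[OF M ty ty] uv
      by (intro cf_inj[OF M]) (auto simp: k algebra_simps)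
  qed
qed

lemma line_homI:
  assumes "hermitian_line L" "hermitian_line M" "f \<in> vecs L \<rightarrow>\<^sub>E vecs M"
    "cmod k = 1" "\<And>u. u \<in> vecs L \<Longrightarrow> cf M (f u) = k * cf L u"
  shows "(L, f, M) \<in> homset lines L M"
  using assms isometry_iff[OF assms(1,2)] by (auto simp: homset_def lines_def)

lemma line_homE:
  assumes "F \<in> homset lines L M"
  obtains f k where "F = (L, f, M)" "hermitian_line L" "hermitian_line M" "f \<in> vecs L \<rightarrow>\<^sub>E vecs M"
    "\<And>u. u \<in> vecs L \<Longrightarrow> f u \<in> vecs M"
    "cmod k = 1" "\<And>u. u \<in> vecs L \<Longrightarrow> cf M (f u) = k * cf L u"
proof -
  obtain f where f: "F = (L, f, M)" "hermitian_line L" "hermitian_line M" "line_isometry L M f"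
    using assms by (auto simp: homset_def lines_def)
  show ?thesis using that f isometry_iff[OF f(2,3)] by (metis PiE_mem)
qed

lemma cf_tens_vec: "\<lbrakk>hermitian_line L; hermitian_line M\<rbrakk> \<Longrightarrow>
    \<exists>k. cmod k = 1 \<and> k \<noteq> 0 \<and> (\<forall>u\<in>vecs L. \<forall>v\<in>vecs M. cf (tensor_line L M) (tens L M u v) = k * (cf L u * cf M v))"
  using cf_tens[of L M] by (metis norm_zero zero_neq_one)

lemma tensor_homI:
  assumes L: "hermitian_line L" and M: "hermitian_line M" and N: "hermitian_line N"
    and b: "\<And>u v. \<lbrakk>u \<in> vecs L; v \<in> vecs M\<rbrakk> \<Longrightarrow> f (tens L M u v) \<in> vecs N"
    and e: "f \<in> extensional (vecs (tensor_line L M))"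
    and c: "\<And>u v. \<lbrakk>u \<in> vecs L; v \<in> vecs M\<rbrakk> \<Longrightarrow> cf N (f (tens L M u v)) = k * (cf L u * cf M v)"
    and k: "cmod k = 1"
  shows "(tensor_line L M, f, N) \<in> homset lines (tensor_line L M) N"
proof -
  obtain m where m: "cmod m = 1" "m \<noteq> 0" "\<And>u v. \<lbrakk>u \<in> vecs L; v \<in> vecs M\<rbrakk> \<Longrightarrow> cf (tensor_line L M) (tens L M u v) = m * (cf L u * cf M v)"
    using cf_tens_vec[OF L M] by blast
  show ?thesis
  proof (rule line_homI[where k = "k / m"])
    show "f \<in> vecs (tensor_line L M) \<rightarrow>\<^sub>E vecs N" using b e by (auto simp: PiE_def elim!: tens_cases)
    show "cmod (k / m) = 1" using k m by (simp add: norm_divide)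
    show "cf N (f u) = k / m * cf (tensor_line L M) u" if "u \<in> vecs (tensor_line L M)" for u
      using that by (rule tens_cases) (use m c in auto)
  qed (use L M N tensor_is_line in auto)
qed

lemma isos_lines: assumes "F \<in> homset lines L M" shows "F \<in> isos lines L M"
proof -
  obtain f k where f: "F = (L, f, M)" and L: "hermitian_line L" and M: "hermitian_line M"
    and t: "\<And>u. u \<in> vecs L \<Longrightarrow> f u \<in> vecs M" and k: "cmod k = 1" and c: "\<And>u. u \<in> vecs L \<Longrightarrow> cf M (f u) = k * cf L u"
    using assms by (rule line_homE) blast
  have k0: "k \<noteq> 0" using k by auto
  define g where "g = (\<lambda>v\<in>vecs M. SOME u. u \<in> vecs L \<and> cf L u = cf M v / k)"
  have "g v \<in> vecs L \<and> cf L (g v) = cf M v / k" if "v \<in> vecs M" for v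
  proof -
    have "\<exists>u. u \<in> vecs L \<and> cf L u = cf M v / k" using coord_surj[OF coord_cf[OF L]] by blast
    from someI_ex[OF this] show ?thesis using that by (simp add: g_def)
  qed
  then have g: "v \<in> vecs M \<Longrightarrow> g v \<in> vecs L" "v \<in> vecs M \<Longrightarrow> cf L (g v) = cf M v / k" for v by blast+
  have "(M, g, L) \<in> homset lines M L"
    by (rule line_homI[where k = "1/k"]) (use L M k g in \<open>auto simp: norm_divide PiE_def g_def\<close>)
  moreover have "g (f u) = u" if "u \<in> vecs L" for u
    by (rule cf_inj[OF L]) (use that g t c k0 in auto)
  moreover have "f (g v) = v" if "v \<in> vecs M" for v
    by (rule cf_inj[OF M]) (use that g t c k0 in auto)
  ultimately show ?thesis using assms unfolding isos_def f
    by (auto simp: lines_def compose_def fun_eq_iff intro!: bexI[of _ "(M, g, L)"])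
qed

lemma Ident_hom: "hermitian_line L \<Longrightarrow> Ident lines L \<in> homset lines L L"
  by (auto simp: lines_def homset_def line_isometry_def cf_simps)

lemma Comp_eq: "Comp lines (M, g, N) (L, f, M') = (L, compose (vecs L) g f, N)"
  and Ident_eq: "Ident lines L = (L, \<lambda>u\<in>vecs L. u, L)"
  and TensorO_eq: "TensorO lines = tensor_line" and UnitO_eq: "UnitO lines = complex_line"
  and Obj_eq: "Obj lines = Collect hermitian_line"
  by (auto simp: lines_def)

lemma TensorA_hom:
  assumes "F \<in> homset lines L L'" "G \<in> homset lines M M'"
  shows "\<exists>h. TensorA lines F G = (tensor_line L M, h, tensor_line L' M') \<and>
      h \<in> extensional (vecs (tensor_line L M)) \<and>
      (\<forall>u\<in>vecs L. \<forall>v\<in>vecs M. h (tens L M u v) = tens L' M' (fst (snd F) u) (fst (snd G) v)) \<and>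
      TensorA lines F G \<in> homset lines (tensor_line L M) (tensor_line L' M')"
proof -
  obtain f k where f: "F = (L, f, L')" and L: "hermitian_line L" and L': "hermitian_line L'"
    and ft: "\<And>u. u \<in> vecs L \<Longrightarrow> f u \<in> vecs L'" and k: "cmod k = 1" and fc: "\<And>u. u \<in> vecs L \<Longrightarrow> cf L' (f u) = k * cf L u"
    using assms(1) by (rule line_homE) blast
  obtain g l where g: "G = (M, g, M')" and M: "hermitian_line M" and M': "hermitian_line M'"
    and gt: "\<And>u. u \<in> vecs M \<Longrightarrow> g u \<in> vecs M'" and l: "cmod l = 1" and gc: "\<And>u. u \<in> vecs M \<Longrightarrow> cf M' (g u) = l * cf M u"
    using assms(2) by (rule line_homE) blast
  obtain m where m: "cmod m = 1" "m \<noteq> 0" "\<And>u v. \<lbrakk>u \<in> vecs L'; v \<in> vecs M'\<rbrakk> \<Longrightarrow> cf (tensor_line L' M') (tens L' M' u v) = m * (cf L' u * cf M' v)"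
    using cf_tens_vec[OF L' M'] by blast
  define h where "h = (\<lambda>p\<in>vecs (tensor_line L M). on_tensor (\<lambda>u v. tens L' M' (f u) (g v)) p)"
  have h: "h (tens L M u v) = tens L' M' (f u) (g v)" if "u \<in> vecs L" "v \<in> vecs M" for u v
    unfolding h_def using that
    by simp (rule on_tensor_map[OF L M tensor_is_line[OF L' M'], where k = "m * k * l"], auto simp: m ft gt fc gc)
  have "(tensor_line L M, h, tensor_line L' M') \<in> homset lines (tensor_line L M) (tensor_line L' M')"
    by (rule tensor_homI[where k = "m * k * l"])
       (use L M L' M' tensor_is_line h ft gt m k l fc gc in \<open>auto simp: h_def[symmetric] norm_mult, auto simp: h_def\<close>)
  then show ?thesis using h by (auto simp: f g lines_def h_def)
qed

definition cw where "cw L M = (SOME k. cmod k = 1 \<and> k \<noteq> 0 \<and> (\<forall>u\<in>vecs L. \<forall>v\<in>vecs M. cf (tensor_line L M) (tens L M u v) = k * (cf L u * cf M v)))"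

lemma cw: assumes "hermitian_line L" "hermitian_line M"
  shows "cmod (cw L M) = 1" "cw L M \<noteq> 0"
    "\<lbrakk>u \<in> vecs L; v \<in> vecs M\<rbrakk> \<Longrightarrow> cf (tensor_line L M) (tens L M u v) = cw L M * (cf L u * cf M v)"
  using someI_ex[OF cf_tens_vec[OF assms]] unfolding cw_def by blast+

lemma Assoc_hom:
  assumes L: "hermitian_line L" and M: "hermitian_line M" and N: "hermitian_line N"
  shows "\<exists>h. Assoc lines L M N = (tensor_line (tensor_line L M) N, h, tensor_line L (tensor_line M N)) \<and>
      h \<in> extensional (vecs (tensor_line (tensor_line L M) N)) \<and>
      (\<forall>u\<in>vecs L. \<forall>v\<in>vecs M. \<forall>w\<in>vecs N. h (tens (tensor_line L M) N (tens L M u v) w) = tens L (tensor_line M N) u (tens M N v w)) \<and>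
      Assoc lines L M N \<in> homset lines (tensor_line (tensor_line L M) N) (tensor_line L (tensor_line M N))"
proof -
  note LM = tensor_is_line[OF L M] and MN = tensor_is_line[OF M N]
  note T = tensor_is_line[OF L MN]
  define k where "k = cw L (tensor_line M N) * cw M N / cw L M"
  have kn: "cmod k = 1" using cw[OF L MN] cw[OF M N] cw[OF L M] by (simp add: k_def norm_mult norm_divide)
  have inner: "on_tensor (\<lambda>u v. tens L (tensor_line M N) u (tens M N v w)) (tens L M u v) = tens L (tensor_line M N) u (tens M N v w)"
    if "u \<in> vecs L" "v \<in> vecs M" "w \<in> vecs N" for u v w
    by (rule on_tensor_map[OF L M T, where k = "cw L (tensor_line M N) * cw M N * cf N w"])
       (use that in \<open>auto simp: cw[OF L MN] cw[OF M N]\<close>)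
  define h where "h = (\<lambda>p\<in>vecs (tensor_line (tensor_line L M) N).
           on_tensor (\<lambda>q w. on_tensor (\<lambda>u v. tens L (tensor_line M N) u (tens M N v w)) q) p)"
  have b: "on_tensor (\<lambda>u v. tens L (tensor_line M N) u (tens M N v w)) q \<in> vecs (tensor_line L (tensor_line M N)) \<and>
     cf (tensor_line L (tensor_line M N)) (on_tensor (\<lambda>u v. tens L (tensor_line M N) u (tens M N v w)) q) =
        k * (cf (tensor_line L M) q * cf N w)" if "q \<in> vecs (tensor_line L M)" "w \<in> vecs N" for q w
    using that(1) by (rule tens_cases) (use that cw(2)[OF L M] in \<open>auto simp: inner cw(3)[OF L MN] cw(3)[OF M N] cw(3)[OF L M] k_def\<close>)
  have h1: "h (tens (tensor_line L M) N q w) = on_tensor (\<lambda>u v. tens L (tensor_line M N) u (tens M N v w)) q"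
    if "q \<in> vecs (tensor_line L M)" "w \<in> vecs N" for q w
    unfolding h_def using that by simp (rule on_tensor_map[OF LM N T], rule b)
  have "(tensor_line (tensor_line L M) N, h, tensor_line L (tensor_line M N)) \<in> homset lines (tensor_line (tensor_line L M) N) (tensor_line L (tensor_line M N))"
    by (rule tensor_homI[where k = k])
       (use LM N T h1 b kn in \<open>auto simp: h_def[symmetric], auto simp: h_def\<close>)
  then show ?thesis using h1 inner by (auto simp: lines_def h_def)
qed

lemma LUnit_hom:
  fixes L :: "'v vec hline"
  assumes L: "hermitian_line L"
  shows "\<exists>h. LUnit lines L = (tensor_line complex_line L, h, L) \<and>
      h \<in> extensional (vecs (tensor_line complex_line L)) \<and>
      (\<forall>c. \<forall>u\<in>vecs L. h (tens complex_line L (Scalar c) u) = vscale L c u) \<and>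
      LUnit lines L \<in> homset lines (tensor_line complex_line L) L"
proof -
  obtain k where k: "cmod k = 1" "\<And>u::'v vec. u \<in> vecs complex_line \<Longrightarrow> scalar_of u = k * cf complex_line u"
    using coord_unique[OF coord_cf[OF complex_is_line] complex_coord] by blast
  define h where "h = (\<lambda>p\<in>vecs (tensor_line complex_line L). on_tensor (\<lambda>c u. vscale L (scalar_of c) u) p)"
  have h: "h (tens complex_line L c u) = vscale L (scalar_of c) u" if "c \<in> vecs complex_line" "u \<in> vecs L" for c u
    unfolding h_def using that
    by simp (rule on_tensor_map[OF complex_is_line L L, where k = k], auto simp: k cf_simps L)
  have "(tensor_line complex_line L, h, L) \<in> homset lines (tensor_line complex_line L) L"
    by (rule tensor_homI[where k = k])
       (simp_all add: L complex_is_line h k cf_scale, simp add: h_def)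
  moreover have "(Scalar c :: 'v vec) \<in> vecs complex_line" for c by (simp add: complex_line_def)
  moreover have "LUnit lines L = (tensor_line complex_line L, h, L)" by (simp add: lines_def h_def)
  moreover have "h \<in> extensional (vecs (tensor_line complex_line L))" by (simp add: h_def)
  ultimately show ?thesis using h by simp
qed

lemma RUnit_hom:
  fixes L :: "'v vec hline"
  assumes L: "hermitian_line L"
  shows "\<exists>h. RUnit lines L = (tensor_line L complex_line, h, L) \<and>
      h \<in> extensional (vecs (tensor_line L complex_line)) \<and>
      (\<forall>c. \<forall>u\<in>vecs L. h (tens L complex_line u (Scalar c)) = vscale L c u) \<and>
      RUnit lines L \<in> homset lines (tensor_line L complex_line) L"
proof -
  obtain k where k: "cmod k = 1" "\<And>u::'v vec. u \<in> vecs complex_line \<Longrightarrow> scalar_of u = k * cf complex_line u"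
    using coord_unique[OF coord_cf[OF complex_is_line] complex_coord] by blast
  define h where "h = (\<lambda>p\<in>vecs (tensor_line L complex_line). on_tensor (\<lambda>u c. vscale L (scalar_of c) u) p)"
  have h: "h (tens L complex_line u c) = vscale L (scalar_of c) u" if "c \<in> vecs complex_line" "u \<in> vecs L" for c u
    unfolding h_def using that
    by simp (rule on_tensor_map[OF L complex_is_line L, where k = k], auto simp: k cf_simps L)
  have "(tensor_line L complex_line, h, L) \<in> homset lines (tensor_line L complex_line) L"
    by (rule tensor_homI[where k = k])
       (simp_all add: L complex_is_line h k cf_scale, simp add: h_def)
  moreover have "(Scalar c :: 'v vec) \<in> vecs complex_line" for c by (simp add: complex_line_def)
  moreover have "RUnit lines L = (tensor_line L complex_line, h, L)" by (simp add: lines_def h_def)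
  moreover have "h \<in> extensional (vecs (tensor_line L complex_line))" by (simp add: h_def)
  ultimately show ?thesis using h by simp
qed

lemma Braid_hom:
  assumes L: "hermitian_line L" and M: "hermitian_line M"
  shows "\<exists>h. Braid lines L M = (tensor_line L M, h, tensor_line M L) \<and>
      h \<in> extensional (vecs (tensor_line L M)) \<and>
      (\<forall>u\<in>vecs L. \<forall>v\<in>vecs M. h (tens L M u v) = tens M L v u) \<and>
      Braid lines L M \<in> homset lines (tensor_line L M) (tensor_line M L)"
proof -
  define h where "h = (\<lambda>p\<in>vecs (tensor_line L M). on_tensor (\<lambda>u v. tens M L v u) p)"
  have h: "h (tens L M u v) = tens M L v u" if "u \<in> vecs L" "v \<in> vecs M" for u v
    unfolding h_def using that
    by simp (rule on_tensor_map[OF L M tensor_is_line[OF M L], where k = "cw M L"], auto simp: cw[OF M L])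
  have "(tensor_line L M, h, tensor_line M L) \<in> homset lines (tensor_line L M) (tensor_line M L)"
    by (rule tensor_homI[where k = "cw M L"])
       (use L M tensor_is_line h cw[OF M L] in \<open>auto simp: h_def[symmetric], auto simp: h_def\<close>)
  then show ?thesis using h by (auto simp: lines_def h_def)
qed

lemma homset_objs: "F \<in> homset lines L M \<Longrightarrow> hermitian_line L \<and> hermitian_line M"
  by (auto simp: homset_def lines_def)

lemma complex_cases: "c \<in> vecs complex_line \<Longrightarrow> (\<And>z. c = Scalar z \<Longrightarrow> P) \<Longrightarrow> P"
  by (auto simp: complex_line_def)

lemma lines_comp_hom:
  assumes "f \<in> homset lines L M" "g \<in> homset lines M N"
  shows "Comp lines g f \<in> homset lines L N"
proof -
  obtain f' k where f: "f = (L, f', M)" "hermitian_line L" "hermitian_line M" "f' \<in> vecs L \<rightarrow>\<^sub>E vecs M"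
    "\<And>u. u \<in> vecs L \<Longrightarrow> f' u \<in> vecs M" "cmod k = 1" "\<And>u. u \<in> vecs L \<Longrightarrow> cf M (f' u) = k * cf L u"
    using assms(1) by (rule line_homE) blast
  obtain g' l where g: "g = (M, g', N)" "hermitian_line M" "hermitian_line N" "g' \<in> vecs M \<rightarrow>\<^sub>E vecs N"
    "\<And>u. u \<in> vecs M \<Longrightarrow> g' u \<in> vecs N" "cmod l = 1" "\<And>u. u \<in> vecs M \<Longrightarrow> cf N (g' u) = l * cf M u"
    using assms(2) by (rule line_homE) blast
  show ?thesis unfolding f(1) g(1) Comp_eq
    by (rule line_homI[where k = "l * k"]) (use f g in \<open>auto simp: norm_mult compose_def\<close>)
qed

lemma smult_bal: "\<lbrakk>hermitian_line L; hermitian_line M; u \<in> vecs L; v \<in> vecs M\<rbrakk>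
   \<Longrightarrow> tens L M (vscale L c u) v = tens L M u (vscale M c v)"
  by (rule tens_eq) (auto simp: cf_simps)

lemma hom_eqI:
  assumes "F \<in> homset lines L M" "G \<in> homset lines L M"
    and "\<And>u. u \<in> vecs L \<Longrightarrow> fst (snd F) u = fst (snd G) u"
  shows "F = G"
  using assms by (elim line_homE) (auto intro!: extensionalityI[of _ "vecs L"] simp: PiE_def)

lemma comp_app: "\<lbrakk>f \<in> homset lines L M; u \<in> vecs L\<rbrakk> \<Longrightarrow> fst (snd (Comp lines g f)) u = fst (snd g) (fst (snd f) u)"
  by (cases g) (auto simp: homset_def lines_def compose_def)

lemma app_in: "\<lbrakk>f \<in> homset lines L M; u \<in> vecs L\<rbrakk> \<Longrightarrow> fst (snd f) u \<in> vecs M"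
  by (erule line_homE) auto

lemma app_scale: "\<lbrakk>f \<in> homset lines L M; u \<in> vecs L\<rbrakk> \<Longrightarrow> fst (snd f) (vscale L c u) = vscale M c (fst (snd f) u)"
  by (auto simp: homset_def lines_def line_isometry_def)

lemma ident_app: "u \<in> vecs L \<Longrightarrow> fst (snd (Ident lines L)) u = u"
  by (simp add: lines_def)

lemma tensor_app: "\<lbrakk>F \<in> homset lines L L'; G \<in> homset lines M M'; u \<in> vecs L; v \<in> vecs M\<rbrakk>
  \<Longrightarrow> fst (snd (TensorA lines F G)) (tens L M u v) = tens L' M' (fst (snd F) u) (fst (snd G) v)"
  using TensorA_hom[of F L L' G M M'] by fastforce

lemma TensorA_h: "\<lbrakk>F \<in> homset lines L L'; G \<in> homset lines M M'\<rbrakk> \<Longrightarrow>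
   TensorA lines F G \<in> homset lines (tensor_line L M) (tensor_line L' M')"
  using TensorA_hom[of F L L' G M M'] by blast

lemma Assoc_h: "\<lbrakk>hermitian_line L; hermitian_line M; hermitian_line N\<rbrakk> \<Longrightarrow>
   Assoc lines L M N \<in> homset lines (tensor_line (tensor_line L M) N) (tensor_line L (tensor_line M N))"
  using Assoc_hom[of L M N] by blast

lemma assoc_app: "\<lbrakk>hermitian_line L; hermitian_line M; hermitian_line N; u \<in> vecs L; v \<in> vecs M; w \<in> vecs N\<rbrakk> \<Longrightarrow>
   fst (snd (Assoc lines L M N)) (tens (tensor_line L M) N (tens L M u v) w) = tens L (tensor_line M N) u (tens M N v w)"
  using Assoc_hom[of L M N] by fastforce

lemma LUnit_h: "hermitian_line L \<Longrightarrow> LUnit lines L \<in> homset lines (tensor_line complex_line L) L"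
  using LUnit_hom[of L] by blast
lemma RUnit_h: "hermitian_line L \<Longrightarrow> RUnit lines L \<in> homset lines (tensor_line L complex_line) L"
  using RUnit_hom[of L] by blast
lemma lunit_app: "\<lbrakk>hermitian_line L; u \<in> vecs L\<rbrakk> \<Longrightarrow>
   fst (snd (LUnit lines L)) (tens complex_line L (Scalar c) u) = vscale L c u"
  using LUnit_hom[of L] by fastforce
lemma runit_app: "\<lbrakk>hermitian_line L; u \<in> vecs L\<rbrakk> \<Longrightarrow>
   fst (snd (RUnit lines L)) (tens L complex_line u (Scalar c)) = vscale L c u"
  using RUnit_hom[of L] by fastforce

lemma Braid_h: "\<lbrakk>hermitian_line L; hermitian_line M\<rbrakk> \<Longrightarrow> Braid lines L M \<in> homset lines (tensor_line L M) (tensor_line M L)"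
  using Braid_hom[of L M] by blast
lemma braid_app: "\<lbrakk>hermitian_line L; hermitian_line M; u \<in> vecs L; v \<in> vecs M\<rbrakk> \<Longrightarrow>
   fst (snd (Braid lines L M)) (tens L M u v) = tens M L v u"
  using Braid_hom[of L M] by fastforce

lemmas homs = lines_comp_hom TensorA_h Assoc_h LUnit_h RUnit_h Braid_h Ident_hom tensor_is_line complex_is_line

lemma in_complex [simp]: "Scalar c \<in> vecs complex_line" by (simp add: complex_line_def)

lemma lines_symmetric_monoidal: "symmetric_monoidal_category (lines :: ('v vec hline, 'v vec line_map) moncat)"
proof (unfold_locales, unfold TensorO_eq UnitO_eq Obj_eq mem_Collect_eq)
  fix f :: "'v vec line_map" assume "f \<in> Arr lines"
  then show "hermitian_line (Dom lines f)" "hermitian_line (Cod lines f)" by (auto simp: lines_def)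
next
  fix x :: "'v vec hline" assume "hermitian_line x"
  then show "Ident lines x \<in> homset lines x x" by (rule Ident_hom)
next
  fix f g :: "'v vec line_map" and x y z assume "f \<in> homset lines x y" "g \<in> homset lines y z"
  then show "Comp lines g f \<in> homset lines x z" by (rule lines_comp_hom)
next
  fix f :: "'v vec line_map" and x y assume f: "f \<in> homset lines x y"
  then have l: "hermitian_line x" "hermitian_line y" by (auto dest: homset_objs)
  show "Comp lines (Ident lines y) f = f"
    by (rule hom_eqI[OF lines_comp_hom[OF f Ident_hom] f]) (use f l in \<open>auto simp: comp_app[OF f] ident_app app_in[OF f]\<close>)
  show "Comp lines f (Ident lines x) = f"
    by (rule hom_eqI[OF lines_comp_hom[OF Ident_hom f] f]) (use f l in \<open>auto simp: comp_app[OF Ident_hom] ident_app\<close>)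
next
  fix f g h :: "'v vec line_map" and w x y z
  assume f: "f \<in> homset lines w x" and g: "g \<in> homset lines x y" and h: "h \<in> homset lines y z"
  note fg = lines_comp_hom[OF f g] and gh = lines_comp_hom[OF g h]
  show "Comp lines (Comp lines h g) f = Comp lines h (Comp lines g f)"
    by (rule hom_eqI[OF lines_comp_hom[OF f gh] lines_comp_hom[OF fg h]])
       (simp add: comp_app[OF f] comp_app[OF g] comp_app[OF fg] app_in[OF f])
next
  show "hermitian_line (complex_line :: 'v vec hline)" by (rule complex_is_line)
next
  fix x y :: "'v vec hline" assume l: "hermitian_line x" "hermitian_line y"
  show "hermitian_line (tensor_line x y)" using l by (rule tensor_is_line)
  show "Braid lines x y \<in> isos lines (tensor_line x y) (tensor_line y x)" using l by (intro isos_lines Braid_h)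
  show "TensorA lines (Ident lines x) (Ident lines y) = Ident lines (tensor_line x y)"
    by (rule hom_eqI, (rule homs l)+)
       (auto elim!: tens_cases simp: ident_app tensor_app[OF Ident_hom Ident_hom] l)
  show "Comp lines (Braid lines y x) (Braid lines x y) = Ident lines (tensor_line x y)"
    by (rule hom_eqI, (rule homs l)+)
       (auto elim!: tens_cases simp: ident_app comp_app[OF Braid_h] braid_app l)
  let ?C = "complex_line :: 'v vec hline"
  note C = complex_is_line
  note a1 = TensorA_h[OF Ident_hom[OF l(1)] LUnit_h[OF l(2)]]
  show "Comp lines (TensorA lines (Ident lines x) (LUnit lines y)) (Assoc lines x complex_line y)
     = TensorA lines (RUnit lines x) (Ident lines y)"
  proof (rule hom_eqI)
    show "Comp lines (TensorA lines (Ident lines x) (LUnit lines y)) (Assoc lines x complex_line y)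
        \<in> homset lines (tensor_line (tensor_line x ?C) y) (tensor_line x y)" by (rule homs l)+
    show "TensorA lines (RUnit lines x) (Ident lines y)
        \<in> homset lines (tensor_line (tensor_line x ?C) y) (tensor_line x y)" by (rule homs l)+
    fix p assume "p \<in> vecs (tensor_line (tensor_line x ?C) y)"
    then show "fst (snd (Comp lines (TensorA lines (Ident lines x) (LUnit lines y)) (Assoc lines x complex_line y))) p
     = fst (snd (TensorA lines (RUnit lines x) (Ident lines y))) p"
      by (auto elim!: tens_cases complex_cases simp: comp_app[OF Assoc_h] assoc_app l C ident_app
          tensor_app[OF Ident_hom LUnit_h] tensor_app[OF RUnit_h Ident_hom] lunit_app runit_app smult_bal)
  qed
next
  fix f g :: "'v vec line_map" and x x' y y' assume f: "f \<in> homset lines x x'" and g: "g \<in> homset lines y y'"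
  then have l: "hermitian_line x" "hermitian_line x'" "hermitian_line y" "hermitian_line y'" by (auto dest: homset_objs)
  show "TensorA lines f g \<in> homset lines (tensor_line x y) (tensor_line x' y')" using f g by (rule TensorA_h)
  show "Comp lines (Braid lines x' y') (TensorA lines f g) = Comp lines (TensorA lines g f) (Braid lines x y)"
    by (rule hom_eqI, (rule homs l f g)+)
       (auto elim!: tens_cases simp: comp_app[OF Braid_h] comp_app[OF TensorA_h[OF f g]] braid_app tensor_app[OF f g]
         tensor_app[OF g f] app_in[OF f] app_in[OF g] l)
next
  fix f f' g g' :: "'v vec line_map" and x x' x'' y y' y''
  assume f: "f \<in> homset lines x x'" and f': "f' \<in> homset lines x' x''"
    and g: "g \<in> homset lines y y'" and g': "g' \<in> homset lines y' y''"
  note ff = lines_comp_hom[OF f f'] and gg = lines_comp_hom[OF g g']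
  show "TensorA lines (Comp lines f' f) (Comp lines g' g) = Comp lines (TensorA lines f' g') (TensorA lines f g)"
    by (rule hom_eqI, (rule homs f f' g g')+)
       (auto elim!: tens_cases simp: comp_app[OF f] comp_app[OF g] comp_app[OF TensorA_h[OF f g]]
          tensor_app[OF ff gg] tensor_app[OF f g] tensor_app[OF f' g'] app_in[OF f] app_in[OF g])
next
  fix x y z :: "'v vec hline" assume l: "hermitian_line x" "hermitian_line y" "hermitian_line z"
  show "Assoc lines x y z \<in> isos lines (tensor_line (tensor_line x y) z) (tensor_line x (tensor_line y z))"
    using l by (intro isos_lines Assoc_h)
  show "Comp lines (Assoc lines y z x) (Comp lines (Braid lines x (tensor_line y z)) (Assoc lines x y z))
      = Comp lines (TensorA lines (Ident lines y) (Braid lines x z))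
         (Comp lines (Assoc lines y x z) (TensorA lines (Braid lines x y) (Ident lines z)))"
    by (rule hom_eqI, (rule homs l)+)
       (auto elim!: tens_cases simp: comp_app[OF Assoc_h] comp_app[OF lines_comp_hom[OF Assoc_h Braid_h]]
         comp_app[OF lines_comp_hom[OF TensorA_h[OF Braid_h Ident_hom] Assoc_h]]
         comp_app[OF TensorA_h[OF Braid_h Ident_hom]] tensor_app[OF Braid_h Ident_hom]
         tensor_app[OF Ident_hom Braid_h] assoc_app braid_app ident_app l tensor_is_line)
next
  fix x :: "'v vec hline" assume l: "hermitian_line x"
  show "LUnit lines x \<in> isos lines (tensor_line complex_line x) x" using l by (intro isos_lines LUnit_h)
  show "RUnit lines x \<in> isos lines (tensor_line x complex_line) x" using l by (intro isos_lines RUnit_h)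
next
  fix f g h :: "'v vec line_map" and x x' y y' z z'
  assume f: "f \<in> homset lines x x'" and g: "g \<in> homset lines y y'" and h: "h \<in> homset lines z z'"
  then have l: "hermitian_line x" "hermitian_line x'" "hermitian_line y" "hermitian_line y'"
     "hermitian_line z" "hermitian_line z'" by (auto dest: homset_objs)
  show "Comp lines (Assoc lines x' y' z') (TensorA lines (TensorA lines f g) h)
      = Comp lines (TensorA lines f (TensorA lines g h)) (Assoc lines x y z)"
    by (rule hom_eqI, (rule homs l f g h)+)
       (auto elim!: tens_cases simp: comp_app[OF Assoc_h] comp_app[OF TensorA_h[OF TensorA_h[OF f g] h]]
         tensor_app[OF f g] tensor_app[OF TensorA_h[OF f g] h] tensor_app[OF f TensorA_h[OF g h]]
         tensor_app[OF g h] assoc_app app_in[OF f] app_in[OF g] app_in[OF h] l)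
next
  fix f :: "'v vec line_map" and x y assume f: "f \<in> homset lines x y"
  then have l: "hermitian_line x" "hermitian_line y" by (auto dest: homset_objs)
  let ?C = "complex_line :: 'v vec hline"
  note C = complex_is_line
  note i = Ident_hom[OF C]
  show "Comp lines (LUnit lines y) (TensorA lines (Ident lines complex_line) f) = Comp lines f (LUnit lines x)"
    by (rule hom_eqI, (rule homs l f)+)
       (auto elim!: tens_cases complex_cases simp: comp_app[OF LUnit_h] comp_app[OF TensorA_h[OF i f]]
         tensor_app[OF i f] ident_app lunit_app app_in[OF f] app_scale[OF f] l)
  show "Comp lines (RUnit lines y) (TensorA lines f (Ident lines complex_line)) = Comp lines f (RUnit lines x)"
    by (rule hom_eqI, (rule homs l f)+)
       (auto elim!: tens_cases complex_cases simp: comp_app[OF RUnit_h] comp_app[OF TensorA_h[OF f i]]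
         tensor_app[OF f i] ident_app runit_app app_in[OF f] app_scale[OF f] l)
next
  fix w x y z :: "'v vec hline"
  assume l: "hermitian_line w" "hermitian_line x" "hermitian_line y" "hermitian_line z"
  note t = TensorA_h[OF Assoc_h Ident_hom]
  show "Comp lines (Assoc lines w x (tensor_line y z)) (Assoc lines (tensor_line w x) y z)
     = Comp lines (TensorA lines (Ident lines w) (Assoc lines x y z))
        (Comp lines (Assoc lines w (tensor_line x y) z) (TensorA lines (Assoc lines w x y) (Ident lines z)))"
    by (rule hom_eqI, (rule homs l)+)
       (auto elim!: tens_cases simp: comp_app[OF Assoc_h] comp_app[OF lines_comp_hom[OF t Assoc_h]]
         comp_app[OF t] tensor_app[OF Assoc_h Ident_hom] tensor_app[OF Ident_hom Assoc_h]
         assoc_app ident_app l tensor_is_line)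
qed

end

theory Submission
  imports Defs
begin

text \<open>
  The morphism \<open>a'\<close> is the tensor product of \<open>a\<close> with the automorphism \<open>\<partial>b\<close> of the unit object.
  By the smoothness condition \<open>E\<close> sends \<open>\<partial>b\<close> to \<open>exp (2\<pi>i \<integral>\<^sub>b \<omega>) = 1\<close>, because \<open>b\<close> is thin, so
  \<open>E a'\<close> and \<open>E a\<close> are both conjugate to \<open>E a \<otimes> id\<close> under the monoidal structure of \<open>E\<close>.
\<close>

lemma (in symmetric_monoidal_category) iso_right_cancel:
  assumes i: "i \<in> isos C x y" and f: "f \<in> homset C y z" and g: "g \<in> homset C y z"
    and eq: "f \<odot> i = g \<odot> i"
  shows "f = g"
proof -
  obtain j where i': "i \<in> homset C x y" and j: "j \<in> homset C y x" and ij: "i \<odot> j = Ident C y"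
    using i by (auto simp: isos_def)
  have "f = (f \<odot> i) \<odot> j" using comp_assoc[OF j i' f] ij ident_right[OF f] by simp
  also have "\<dots> = g" using comp_assoc[OF j i' g] ij ident_right[OF g] eq by simp
  finally show ?thesis .
qed

text \<open>Naturality of \<open>FMult\<close> writes both images, precomposed with the isomorphism
  \<open>FMult F x y\<close>, in terms of the images of the two factors; the isomorphism is then
  cancelled.\<close>

lemma (in symmetric_monoidal_functor) FArr_tensor_cong:
  assumes f: "f \<in> homset C x x'" and f': "f' \<in> homset C x x'"
    and g: "g \<in> homset C y y'" and g': "g' \<in> homset C y y'"
    and eq: "FArr F f = FArr F f'" "FArr F g = FArr F g'"
  shows "FArr F (f \<boxtimes>\<^bsub>C\<^esub> g) = FArr F (f' \<boxtimes>\<^bsub>C\<^esub> g')"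
proof (rule D.iso_right_cancel)
  have "x \<in> Obj C" "y \<in> Obj C"
    using f g C.dom_obj by (auto simp: homset_def)
  then show "FMult F x y \<in> isos D (FObj F x \<boxdot>\<^bsub>D\<^esub> FObj F y) (FObj F (x \<boxdot>\<^bsub>C\<^esub> y))"
    by (rule mult_iso)
  show "FArr F (f \<boxtimes>\<^bsub>C\<^esub> g) \<in> homset D (FObj F (x \<boxdot>\<^bsub>C\<^esub> y)) (FObj F (x' \<boxdot>\<^bsub>C\<^esub> y'))"
    "FArr F (f' \<boxtimes>\<^bsub>C\<^esub> g') \<in> homset D (FObj F (x \<boxdot>\<^bsub>C\<^esub> y)) (FObj F (x' \<boxdot>\<^bsub>C\<^esub> y'))"
    by (intro arr C.tensor_hom f f' g g')+
  show "FArr F (f \<boxtimes>\<^bsub>C\<^esub> g) \<odot>\<^bsub>D\<^esub> FMult F x y = FArr F (f' \<boxtimes>\<^bsub>C\<^esub> g') \<odot>\<^bsub>D\<^esub> FMult F x y"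
    using mult_natural[OF f g] mult_natural[OF f' g'] eq by simp
qed

text \<open>Covers the scalar exp 0 = 1, which the smoothness condition yields when the integral
  vanishes.\<close>

lemma scalar_map_1: "scalar_map 1 = Ident lines complex_line"
  by (auto simp: scalar_map_def lines_def complex_line_def intro!: restrict_ext)

text \<open>The smoothness condition describes the automorphism of E(0) only after transport along
  \<open>FUnit E\<close>, so \<open>FUnit E\<close> has to be cancelled at the end.\<close>

lemma (in chain_field_theory) FArr_boundary_thin:
  assumes b: "b \<in> thin_chains X (n + 2)"
    and hom: "(0, chain_boundary (n + 2) b, 0) \<in> homset (chain_cat n X) 0 0"
  shows "FArr E (0, chain_boundary (n + 2) b, 0) = FArr E (Ident (chain_cat n X) 0)"
proof -
  obtain \<omega> where \<omega>: "closed_form X (n + 2) \<omega>"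
    and E: "\<And>c. c \<in> smooth_chains X (n + 2) \<Longrightarrow>
       FArr E (0, chain_boundary (n + 2) c, 0) \<odot>\<^bsub>lines\<^esub> FUnit E
       = FUnit E \<odot>\<^bsub>lines\<^esub> scalar_map (exp (2 * of_real pi * \<i> * of_real (chain_integral (n + 2) \<omega> c)))"
    using smoothness by blast
  \<comment> \<open>Thinness applies to \<omega> because a closed form is in particular a member of
    \<open>forms\<close>.\<close>
  have "chain_integral (n + 2) \<omega> b = 0" "b \<in> smooth_chains X (n + 2)"
    using \<omega> b by (simp_all add: closed_form_def thin_chains_def)
  then have boundary: "FArr E (0, chain_boundary (n + 2) b, 0) \<odot>\<^bsub>lines\<^esub> FUnit E
      = FUnit E \<odot>\<^bsub>lines\<^esub> Ident lines complex_line"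
    using E[of b] by (simp add: scalar_map_1)
  have obj0: "0 \<in> Obj (chain_cat n X)" by (simp add: chain_cat_def)
  have unit: "FUnit E \<in> isos lines complex_line (FObj E 0)"
    using unit_iso by (simp add: chain_cat_def UnitO_eq)
  then have unit_hom: "FUnit E \<in> homset lines complex_line (FObj E 0)"
    by (simp add: isos_def)
  show ?thesis
  proof (rule D.iso_right_cancel[OF unit arr[OF hom]])
    show "FArr E (Ident (chain_cat n X) 0) \<in> homset lines (FObj E 0) (FObj E 0)"
      by (intro arr C.ident_hom obj0)
    \<comment> \<open>Both sides equal \<open>FUnit E\<close>.\<close>
    show "FArr E (0, chain_boundary (n + 2) b, 0) \<odot>\<^bsub>lines\<^esub> FUnit E
        = FArr E (Ident (chain_cat n X) 0) \<odot>\<^bsub>lines\<^esub> FUnit E"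
      using boundary D.ident_right[OF unit_hom] D.ident_left[OF unit_hom] ident[OF obj0] by simp
  qed
qed

lemma smooth_chains_diff:
  "\<lbrakk>a \<in> smooth_chains X p; b \<in> smooth_chains X p\<rbrakk> \<Longrightarrow> a - b \<in> smooth_chains X p"
  using keys_diff[of a b] by (auto simp: smooth_chains_def)

theorem proposition9p14:
  fixes X :: "'a diffeology" and n :: nat
    and E :: "('a chain, 'a chain \<times> 'a chain \<times> 'a chain, 'v vec hline, 'v vec line_map) monfun"
    and x x' a a' b :: "'a chain"
  assumes "smooth_space X"
    and "chain_field_theory n X E"
    and "x \<in> Obj (chain_cat n X)" and "x' \<in> Obj (chain_cat n X)"
    and "(x, a, x') \<in> homset (chain_cat n X) x x'"
    and "(x, a', x') \<in> homset (chain_cat n X) x x'"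
    and "b \<in> thin_chains X (n + 2)"
    and "chain_boundary (n + 2) b = a' - a"
  shows "FArr E (x, a, x') = FArr E (x, a', x')"
proof -
  interpret chain_field_theory n X E by fact
  let ?C = "chain_cat n X" and ?z = "(0, chain_boundary (n + 2) b, 0)"
  note a = \<open>(x, a, x') \<in> homset ?C x x'\<close> and a' = \<open>(x, a', x') \<in> homset ?C x x'\<close>
  have z: "?z \<in> homset ?C 0 0"
    unfolding assms(8) using a a'
    by (auto simp: chain_cat_def homset_def smooth_chains_diff chain_boundary_diff)
  have id0: "Ident ?C 0 \<in> homset ?C 0 0"
    by (rule C.ident_hom) (simp add: chain_cat_def)
  have "FArr E ((x, a, x') \<boxtimes>\<^bsub>?C\<^esub> Ident ?C 0) = FArr E ((x, a, x') \<boxtimes>\<^bsub>?C\<^esub> ?z)"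
    by (rule FArr_tensor_cong[OF a a id0 z refl])
      (rule FArr_boundary_thin[OF assms(7) z, symmetric])
  \<comment> \<open>The tensor product adds componentwise with strict unit 0, so the two arguments
    are literally \<open>a + 0 = a\<close> and \<open>a + (a' - a) = a'\<close>, with endpoints
    \<open>x\<close> and \<open>x'\<close>.\<close>
  then show ?thesis unfolding assms(8) by (simp add: chain_cat_def)
qed

end
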